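(* Let $X$ be a homogeneous tree of degree $q+1$ ($2\leq q<\infty$) with graph distance $\mathrm d$ and distinguished vertex $x_0$. For $z\in\mathbb C$ let $$\varphi_z(x)=f(z)q^{-z\,\mathrm d(x,x_0)}+f(1-z)q^{-(1-z)\mathrm d(x,x_0)},\qquad f(z)=(q+1)^{-1}\frac{q^{1-z}-q^{z-1}}{q^{-z}-q^{z-1}},$$ (extended by continuity in $z$ at the removable singularities $z=\tfrac12+i\tfrac{k\pi}{\ln q}$, $k\in\mathbb Z$), and let $\tilde\varphi_z(x,y)$ be the function on $X\times X$ with $\tilde\varphi_z(x,y)=\dot\varphi_z(\mathrm d(x,y))$ where $\varphi_z(x)=\dot\varphi_z(\mathrm d(x,x_0))$. Then $\tilde\varphi_z$ is a Schur multiplier if and only if $$z\in\{z:0<\Re(z)<1\}\cup\{i\tfrac{k\pi}{\ln q}:k\in\mathbb Z\}\cup\{1-i\tfrac{k\pi}{\ln q}:k\in\mathbb Z\}.$$ Moreover, for $0<\Re(z)<1$, $$\|\tilde\varphi_z\|_S=\frac{(1-\frac1q)^2|1-q^{-2z}||1-q^{2z-2}|}{(1-q^{-2\Re(z)})(1-q^{2\Re(z)-2})|1-q^{2i\Im(z)-1}|^2},$$ and $\|\tilde\varphi_z\|_S=1$ for $z\in\{i\tfrac{k\pi}{\ln q}\}\cup\{1-i\tfrac{k\pi}{\ln q}\}$.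
   Context: A homogeneous tree of degree $q+1$ is a connected cycle-free graph in which every vertex has exactly $q+1$ neighbours. A function $\psi:X\times X\to\mathbb C$ is a Schur multiplier if for every bounded operator $A=(a_{x,y})$ on $\ell^2(X)$ the matrix $(\psi(x,y)a_{x,y})$ again defines a bounded operator $M_\psi A$; $\|\psi\|_S:=\|M_\psi\|$. *)

theory Defs
  imports "HOL-Analysis.Analysis"
begin

definition walk :: "('a \<Rightarrow> 'a \<Rightarrow> bool) \<Rightarrow> 'a list \<Rightarrow> bool" where
  "walk E xs \<longleftrightarrow> xs \<noteq> [] \<and> (\<forall>i. Suc i < length xs \<longrightarrow> E (xs ! i) (xs ! Suc i))"

definition connected_graph :: "('a \<Rightarrow> 'a \<Rightarrow> bool) \<Rightarrow> bool" where
  "connected_graph E \<longleftrightarrow> (\<forall>x y. \<exists>xs. walk E xs \<and> hd xs = x \<and> last xs = y)"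

definition cycle_free :: "('a \<Rightarrow> 'a \<Rightarrow> bool) \<Rightarrow> bool" where
  "cycle_free E \<longleftrightarrow>
     \<not> (\<exists>xs. walk E xs \<and> distinct xs \<and> 3 \<le> length xs \<and> E (last xs) (hd xs))"

definition homogeneous_tree :: "('a \<Rightarrow> 'a \<Rightarrow> bool) \<Rightarrow> nat \<Rightarrow> bool" where
  "homogeneous_tree E d \<longleftrightarrow>
     (\<forall>x y. E x y \<longrightarrow> E y x) \<and> (\<forall>x. \<not> E x x) \<and>
     connected_graph E \<and> cycle_free E \<and>
     (\<forall>x. finite {y. E x y} \<and> card {y. E x y} = d)"

definition graph_dist :: "('a \<Rightarrow> 'a \<Rightarrow> bool) \<Rightarrow> 'a \<Rightarrow> 'a \<Rightarrow> nat" where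
  "graph_dist E x y =
     (LEAST n. \<exists>xs. walk E xs \<and> hd xs = x \<and> last xs = y \<and> length xs = Suc n)"

text \<open>The values of the bilinear form of a matrix A on finitely supported vectors u, v
  in the unit ball of l2. A matrix defines a bounded operator on l2(X) iff these values are
  bounded, and the operator norm is their supremum.\<close>
definition form_values :: "('a \<Rightarrow> 'a \<Rightarrow> complex) \<Rightarrow> real set" where
  "form_values A = {cmod (\<Sum>x\<in>F. \<Sum>y\<in>F. u x * A x y * v y) | F u v.
      finite F \<and> (\<Sum>x\<in>F. (cmod (u x))\<^sup>2) \<le> 1 \<and> (\<Sum>x\<in>F. (cmod (v x))\<^sup>2) \<le> 1}"

definition bounded_matrix :: "('a \<Rightarrow> 'a \<Rightarrow> complex) \<Rightarrow> bool" where
  "bounded_matrix A \<longleftrightarrow> bdd_above (form_values A)"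

definition matrix_norm :: "('a \<Rightarrow> 'a \<Rightarrow> complex) \<Rightarrow> real" where
  "matrix_norm A = Sup (form_values A)"

definition schur_multiplier :: "('a \<Rightarrow> 'a \<Rightarrow> complex) \<Rightarrow> bool" where
  "schur_multiplier \<psi> \<longleftrightarrow>
     (\<forall>A. bounded_matrix A \<longrightarrow> bounded_matrix (\<lambda>x y. \<psi> x y * A x y))"

definition schur_norm :: "('a \<Rightarrow> 'a \<Rightarrow> complex) \<Rightarrow> real" where
  "schur_norm \<psi> = Sup {matrix_norm (\<lambda>x y. \<psi> x y * A x y) | A.
                        bounded_matrix A \<and> matrix_norm A \<le> 1}"

definition qpow :: "nat \<Rightarrow> complex \<Rightarrow> complex" where
  "qpow q w = exp (w * of_real (ln (real q)))"

definition sph_f :: "nat \<Rightarrow> complex \<Rightarrow> complex" where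
  "sph_f q z = inverse (of_nat q + 1) *
      ((qpow q (1 - z) - qpow q (z - 1)) / (qpow q (- z) - qpow q (z - 1)))"

definition sph_raw :: "nat \<Rightarrow> complex \<Rightarrow> nat \<Rightarrow> complex" where
  "sph_raw q z n = sph_f q z * qpow q (- z * of_nat n) + sph_f q (1 - z) * qpow q (- (1 - z) * of_nat n)"

text \<open>dot-phi_z(n), extended by continuity in z at the removable singularities
  (where q^(-z) = q^(z-1)).\<close>
definition sph_dot :: "nat \<Rightarrow> complex \<Rightarrow> nat \<Rightarrow> complex" where
  "sph_dot q z n = (if qpow q (- z) \<noteq> qpow q (z - 1) then sph_raw q z n
                    else Lim (at z) (\<lambda>w. sph_raw q w n))"

end

theory Submission
  imports Defs
begin

text \<open>
  Put \<open>\<alpha> = q\<^sup>-\<^sup>z\<close>, \<open>\<beta> = q\<^sup>z\<^sup>-\<^sup>1\<close>, so that \<open>\<alpha>\<beta> = 1/q\<close>, and let \<open>U n\<close> be the complete homogeneous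
  polynomial of degree \<open>n\<close> in \<open>\<alpha>, \<beta>\<close>. The spherical function satisfies
  \<open>\<Phi> n - \<Phi> (n + 2) = C U n\<close>, and the identity \<open>U i U j - \<alpha>\<beta> U (i - 1) U (j - 1) = U (i + j)\<close> shows
  that after inverting \<open>T \<mapsto> T - (1/q) S T S\<^sup>*\<close> (\<open>S\<close> the unilateral shift) the Hankel matrix of these
  differences becomes the rank one matrix \<open>C U i U j\<close>. Seen from a far away end, the kernel
  therefore factors as \<open>C \<langle>P x, P y\<rangle>\<close>, where \<open>P x\<close> is the sum over the ancestors of \<open>x\<close> of \<open>U i\<close> times
  the \<open>i\<close>-th ancestor projected off the constants on its siblings. This gives the upper bound
  \<open>|C| (1 - 1/q) \<Sum> |U i|\<^sup>2\<close>.

  For the lower bound, a matrix of the same shape with weights \<open>k\<close> in place of \<open>U\<close> has norm at most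
  \<open>\<Sum> |k i|\<^sup>2 q\<^sup>i\<close>, and testing its Schur product against radial vectors yields
  \<open>|C| (1 - 1/q) |\<Sum> U i k i q\<^sup>i\<^sup>/\<^sup>2|\<^sup>2\<close> in the limit. The two bounds agree for \<open>k i\<close> proportional to
  \<open>cnj (U i) q\<^sup>-\<^sup>i\<^sup>/\<^sup>2\<close>. Outside the strip \<open>U\<close> is not square summable, so the multiplier property fails
  unless \<open>C = 0\<close>, in which case \<open>\<Phi> n = (\<plusminus>1)\<^sup>n\<close>.
\<close>

section \<open>Words as coordinates on a homogeneous tree\<close>

lemma walk_Cons2: "walk E (x # y # zs) \<longleftrightarrow> E x y \<and> walk E (y # zs)"
proof
  assume w: "walk E (x # y # zs)"
  have "E ((y # zs) ! i) ((y # zs) ! Suc i)" if "Suc i < length (y # zs)" for i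
    using w that unfolding walk_def by (auto dest: spec[of _ "Suc i"])
  moreover have "E x y" using w unfolding walk_def by (auto dest: spec[of _ 0])
  ultimately show "E x y \<and> walk E (y # zs)" by (simp add: walk_def)
next
  assume w: "E x y \<and> walk E (y # zs)"
  have "E ((x # y # zs) ! i) ((x # y # zs) ! Suc i)" if "Suc i < length (x # y # zs)" for i
    using w that unfolding walk_def by (cases i) auto
  then show "walk E (x # y # zs)" by (simp add: walk_def)
qed

lemma walk_singleton: "walk E [x]"
  by (simp add: walk_def)

lemma walk_appendD: "walk E (xs @ x # ys) \<Longrightarrow> walk E (xs @ [x])"
proof (induction xs)
  case Nil show ?case by (simp add: walk_singleton)
next
  case (Cons a xs) then show ?case by (cases xs) (auto simp: walk_Cons2)
qed

lemma walk_last_step: "walk E (xs @ [x]) \<Longrightarrow> xs \<noteq> [] \<Longrightarrow> E (last xs) x \<and> walk E xs"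
proof (induction xs)
  case Nil then show ?case by simp
next
  case (Cons a xs) then show ?case by (cases xs) (auto simp: walk_Cons2 walk_singleton)
qed

section \<open>Walks without backtracking, which are the geodesics of a tree\<close>

fun nonbacktracking :: "'a list \<Rightarrow> bool" where
  "nonbacktracking (x # y # z # zs) \<longleftrightarrow> x \<noteq> z \<and> nonbacktracking (y # z # zs)"
| "nonbacktracking _ \<longleftrightarrow> True"

definition nb_walk :: "('a \<Rightarrow> 'a \<Rightarrow> bool) \<Rightarrow> 'a list \<Rightarrow> bool" where
  "nb_walk E xs \<longleftrightarrow> walk E xs \<and> nonbacktracking xs"

lemma nb_walk_simps [simp]:
  "\<not> nb_walk E []"
  "nb_walk E [x]"
  "nb_walk E [x, y] \<longleftrightarrow> E x y"
  "nb_walk E (x # y # z # zs) \<longleftrightarrow> E x y \<and> x \<noteq> z \<and> nb_walk E (y # z # zs)"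
  by (auto simp: nb_walk_def walk_Cons2 walk_singleton) (simp add: walk_def)

lemma nb_walk_tl: "nb_walk E (x # y # zs) \<Longrightarrow> nb_walk E (y # zs)"
  by (cases zs) auto

text \<open>Backtracking is a condition on three consecutive vertices. An overlap of two vertices
  leaves every such triple inside one of the two pieces.\<close>

lemma nb_walk_overlap:
  "nb_walk E (xs @ [a, b]) \<Longrightarrow> nb_walk E (a # b # ys) \<Longrightarrow> nb_walk E (xs @ a # b # ys)"
proof (induction xs)
  case Nil then show ?case by simp
next
  case (Cons x xs)
  then show ?case
  proof (cases xs)
    case (Cons y zs) then show ?thesis using Cons.prems Cons.IH by (cases zs) auto
  qed auto
qed

lemma nb_walk_rev:
  assumes "\<And>x y. E x y \<Longrightarrow> E y x"
  shows "nb_walk E xs \<Longrightarrow> nb_walk E (rev xs)"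
proof (induction xs)
  case (Cons x xs)
  show ?case
  proof (cases xs)
    case (Cons y ys)
    then show ?thesis
    proof (cases ys)
      case (Cons z zs)
      have "E y z" using Cons.prems \<open>xs = y # ys\<close> Cons by (cases zs) auto
      then have "nb_walk E (rev zs @ [z, y])" "nb_walk E [z, y, x]"
        using Cons.IH Cons.prems \<open>xs = y # ys\<close> Cons assms by auto
      from nb_walk_overlap[OF this] show ?thesis using \<open>xs = y # ys\<close> Cons by simp
    qed (use Cons Cons.prems assms in auto)
  qed (use Cons in auto)
qed simp

text \<open>The only new triple is \<open>a, p, b\<close>, and \<open>a \<noteq> b\<close>. Joining
  two walks that leave \<open>p\<close> by different edges is the source of both the uniqueness of
  geodesics and the distance formula for words.\<close>

lemma nb_walk_join:
  assumes "\<And>x y. E x y \<Longrightarrow> E y x"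
    and "nb_walk E (p # a # xs)" "nb_walk E (p # b # ys)" "a \<noteq> b"
  shows "nb_walk E (rev (a # xs) @ p # b # ys)"
proof -
  have "nb_walk E (rev xs @ [a, p])" using nb_walk_rev[of E "p # a # xs"] assms by simp
  moreover have "E p a" using assms(2) by (cases xs) auto
  then have "nb_walk E (a # p # b # ys)" using assms by auto
  ultimately show ?thesis using nb_walk_overlap by fastforce
qed

text \<open>The first vertex is put in front of the reduced tail. If the tail returns to it at once,
  the two opposite edges are cancelled instead, so the length never grows.\<close>

lemma nb_walk_of_walk:
  "walk E xs \<Longrightarrow> \<exists>ys. nb_walk E ys \<and> hd ys = hd xs \<and> last ys = last xs \<and> length ys \<le> length xs"
proof (induction xs)
  case Nil then show ?case by (simp add: walk_def)
next
  case (Cons x xs)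
  show ?case
  proof (cases xs)
    case Nil then show ?thesis by (intro exI[of _ "[x]"]) auto
  next
    case (Cons x' xs')
    then have "E x x'" "walk E xs" using Cons.prems by (auto simp: walk_Cons2)
    from Cons.IH[OF this(2)] obtain ys where ys: "nb_walk E ys" "hd ys = hd xs" "last ys = last xs"
      "length ys \<le> length xs" by auto
    then obtain zs where zs: "ys = x' # zs" using Cons by (cases ys) auto
    show ?thesis
    proof (cases "zs \<noteq> [] \<and> hd zs = x")
      case True
      then show ?thesis using ys zs Cons by (intro exI[of _ zs]) (cases zs; auto dest: nb_walk_tl)
    next
      case False
      then show ?thesis using ys zs Cons \<open>E x x'\<close> by (intro exI[of _ "x # ys"]) (cases zs; auto)
    qed
  qed
qed

locale arity =
  fixes q :: nat
  assumes q_ge_2: "2 \<le> q"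

locale tree = arity +
  fixes E :: "'a \<Rightarrow> 'a \<Rightarrow> bool"
  assumes homogeneous: "homogeneous_tree E (q + 1)"
begin

lemma edge_sym: "E x y \<Longrightarrow> E y x"
  and irrefl: "\<not> E x x"
  and connected: "\<exists>xs. walk E xs \<and> hd xs = x \<and> last xs = y"
  and acyclic: "walk E xs \<Longrightarrow> distinct xs \<Longrightarrow> 3 \<le> length xs \<Longrightarrow> \<not> E (last xs) (hd xs)"
  and finite_neighbours: "finite {y. E x y}"
  and card_neighbours: "card {y. E x y} = q + 1"
  using homogeneous unfolding homogeneous_tree_def connected_graph_def cycle_free_def by blast+

text \<open>The stretch from \<open>x\<close> to its first repetition is a closed path. It has at
  least three vertices, because loops are excluded by irreflexivity and a return after two steps by
  the absence of backtracking. This contradicts acyclicity.\<close>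

lemma nb_walk_distinct: "nb_walk E xs \<Longrightarrow> distinct xs"
proof (induction xs)
  case (Cons x xs)
  show ?case
  proof (cases xs)
    case (Cons y ys)
    then have d: "distinct xs" using Cons.IH Cons.prems nb_walk_tl by metis
    have "x \<notin> set xs"
    proof
      assume "x \<in> set xs"
      then obtain us vs where xs: "xs = us @ x # vs" by (auto dest: split_list)
      have "walk E ((x # us) @ x # vs)" using Cons.prems xs by (simp add: nb_walk_def)
      then have w: "walk E ((x # us) @ [x])" by (rule walk_appendD)
      then have e: "E (last (x # us)) x" "walk E (x # us)" using walk_last_step[OF w] by simp_all
      have "us \<noteq> []" using e(1) irrefl by auto
      moreover have "us \<noteq> [u]" for u using Cons.prems xs by auto
      ultimately have "3 \<le> length (x # us)" by (cases us; cases "tl us") auto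
      moreover have "distinct (x # us)" using d xs by auto
      ultimately show False using acyclic e by force
    qed
    then show ?thesis using d by simp
  qed simp
qed simp

text \<open>Where the two walks part, one reversed and joined to the other has no backtracking, yet
  its two ends coincide, against \<open>nb_walk_distinct\<close>.\<close>

lemma nb_walk_unique:
  "nb_walk E xs \<Longrightarrow> nb_walk E ys \<Longrightarrow> hd xs = hd ys \<Longrightarrow> last xs = last ys \<Longrightarrow> xs = ys"
proof (induction xs arbitrary: ys)
  case (Cons x xs)
  obtain ys' where ys: "ys = x # ys'" using Cons.prems by (cases ys) auto
  have closed: "zs = []" if "nb_walk E (x # zs)" "last (x # zs) = x" for zs
    using nb_walk_distinct[OF that(1)] that(2) by (cases zs rule: rev_cases) auto
  show ?case
  proof (cases "xs = [] \<or> ys' = []")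
    case True
    then have "last (x # xs) = x \<and> last (x # ys') = x"
      using Cons.prems(4) unfolding ys by auto
    moreover have "nb_walk E (x # ys')" using Cons.prems(2) unfolding ys .
    ultimately have "xs = []" "ys' = []" using closed Cons.prems(1) by blast+
    then show ?thesis unfolding ys by simp
  next
    case False
    then obtain a as b bs where xs: "xs = a # as" and ys': "ys' = b # bs"
      by (meson neq_Nil_conv)
    have l: "last (a # as) = last (b # bs)" using Cons.prems ys xs ys' by simp
    show ?thesis
    proof (cases "a = b")
      case True
      have "nb_walk E (a # as)" "nb_walk E (b # bs)"
        using Cons.prems(1,2) xs ys ys' nb_walk_tl by metis+
      then have "xs = ys'" using Cons.IH[of ys'] xs ys' True l by auto
      then show ?thesis using ys by simp
    next
      case False
      have "nb_walk E (rev (a # as) @ x # b # bs)"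
        using nb_walk_join[OF edge_sym] Cons.prems(1,2) xs ys ys' False by auto
      then have "distinct (rev (a # as) @ x # b # bs)" by (rule nb_walk_distinct)
      moreover have "last (a # as) \<in> set (a # as)" "last (b # bs) \<in> set (b # bs)"
        using last_in_set by blast+
      ultimately show ?thesis using l by auto
    qed
  qed
qed simp

text \<open>Every competing walk reduces to a walk without backtracking that is no longer, and by
  uniqueness this is \<open>xs\<close>.\<close>

lemma graph_dist_nb_walk:
  assumes "nb_walk E xs" "hd xs = x" "last xs = y"
  shows "graph_dist E x y = length xs - 1"
  unfolding graph_dist_def
proof (rule Least_equality)
  have "xs \<noteq> []" using assms by auto
  then show "\<exists>ys. walk E ys \<and> hd ys = x \<and> last ys = y \<and> length ys = Suc (length xs - 1)"
    using assms by (intro exI[of _ xs]) (auto simp: nb_walk_def)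
next
  fix n assume "\<exists>ys. walk E ys \<and> hd ys = x \<and> last ys = y \<and> length ys = Suc n"
  then obtain ys where ys: "walk E ys" "hd ys = x" "last ys = y" "length ys = Suc n" by auto
  obtain zs where "nb_walk E zs" "hd zs = x" "last zs = y" "length zs \<le> length ys"
    using nb_walk_of_walk[OF ys(1)] ys by auto
  then show "length xs - 1 \<le> n" using nb_walk_unique[of xs zs] assms ys by auto
qed

lemma ex_nb_walk: "\<exists>xs. nb_walk E (x # xs) \<and> last (x # xs) = y"
proof -
  obtain xs where "walk E xs" "hd xs = x" "last xs = y" using connected by blast
  then obtain ys where ys: "nb_walk E ys" "hd ys = x" "last ys = y"
    using nb_walk_of_walk[of E xs] by auto
  then have "ys = x # tl ys" by (cases ys) auto
  then show ?thesis using ys(1,3) by metis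
qed

section \<open>Words as addresses of the vertices beyond an oriented edge\<close>

definition child :: "'a \<Rightarrow> 'a \<Rightarrow> nat \<Rightarrow> 'a" where
  "child o' p = (SOME f. bij_betw f {..<q} ({y. E p y} - {o'}))"

text \<open>Of the \<open>q + 1\<close> neighbours of \<open>p\<close> one is the parent, so
  \<open>q\<close> remain to be numbered. The numbering itself is an arbitrary choice.\<close>

lemma bij_child:
  assumes "E o' p"
  shows "bij_betw (child o' p) {..<q} ({y. E p y} - {o'})"
proof -
  have "card ({y. E p y} - {o'}) = q"
    using card_neighbours[of p] edge_sym[OF assms] finite_neighbours[of p] by simp
  then have "\<exists>f. bij_betw f {..<q} ({y. E p y} - {o'})"
    using ex_bij_betw_nat_finite[of "{y. E p y} - {o'}"] finite_neighbours[of p]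
    by (auto simp: atLeast0LessThan)
  from someI_ex[OF this] show ?thesis unfolding child_def .
qed

lemma child_props:
  assumes "E o' p" "a < q"
  shows "E p (child o' p a)" "child o' p a \<noteq> o'"
  using bij_betwE[OF bij_child[OF assms(1)]] assms(2) by auto

text \<open>Words are read from the root: \<open>p\<close> is the current vertex and \<open>o'\<close> its parent.\<close>

fun descend :: "'a \<Rightarrow> 'a \<Rightarrow> nat list \<Rightarrow> 'a" where
  "descend o' p [] = p"
| "descend o' p (a # w) = descend p (child o' p a) w"

text \<open>A child differs from the parent of its parent, so descending never backtracks. Keeping
  \<open>o'\<close> in front of the walk carries this condition through the induction.\<close>

lemma descend_nb_walk:
  "E o' p \<Longrightarrow> w \<in> lists {..<q} \<Longrightarrow>
    \<exists>zs. nb_walk E (o' # p # zs) \<and> last (p # zs) = descend o' p w \<and> length zs = length w"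
proof (induction o' p w rule: descend.induct)
  case (1 o' p) then show ?case by (intro exI[of _ "[]"]) auto
next
  case (2 o' p a w)
  then have c: "E p (child o' p a)" "child o' p a \<noteq> o'" using child_props by auto
  with 2 obtain zs where "nb_walk E (p # child o' p a # zs)"
      "last (child o' p a # zs) = descend p (child o' p a) w" "length zs = length w" by auto
  then show ?case using 2 c by (intro exI[of _ "child o' p a # zs"]) auto
qed

text \<open>Each further vertex is a neighbour other than the previous one, hence a child. Words
  therefore reach every vertex on the \<open>p\<close> side of the edge.\<close>

lemma nb_walk_descend:
  "nb_walk E (o' # p # zs) \<Longrightarrow> \<exists>w\<in>lists {..<q}. descend o' p w = last (p # zs)"
proof (induction zs arbitrary: o' p)
  case Nil then show ?case by (intro bexI[of _ "[]"]) auto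
next
  case (Cons z zs)
  then have "E o' p" "z \<noteq> o'" "E p z" "nb_walk E (p # z # zs)" by (auto, cases zs, auto)
  then have "z \<in> child o' p ` {..<q}"
    using bij_betw_imp_surj_on[OF bij_child[OF \<open>E o' p\<close>]] by simp
  then obtain a where "a < q" "z = child o' p a" by auto
  moreover obtain w where "w \<in> lists {..<q}" "descend p z w = last (z # zs)"
    using Cons.IH[OF \<open>nb_walk E (p # z # zs)\<close>] by blast
  ultimately show ?case by (intro bexI[of _ "a # w"]) auto
qed

end

section \<open>The path metric of the rooted tree of words\<close>

fun word_dist :: "nat list \<Rightarrow> nat list \<Rightarrow> nat" where
  "word_dist (a # x) (b # y) = (if a = b then word_dist x y else length x + length y + 2)"
| "word_dist x y = length x + length y"

text \<open>A common letter moves the whole picture to the child, with \<open>p\<close> as new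
  parent. At the first difference the two descents leave \<open>p\<close> by different edges, and
  their join is the geodesic.\<close>

lemma (in tree) graph_dist_descend:
  "E o' p \<Longrightarrow> x \<in> lists {..<q} \<Longrightarrow> y \<in> lists {..<q} \<Longrightarrow>
    graph_dist E (descend o' p x) (descend o' p y) = word_dist x y"
proof (induction x y arbitrary: o' p rule: word_dist.induct)
  case (1 a x b y)
  have a: "E p (child o' p a)" and b: "E p (child o' p b)" using 1 child_props by auto
  show ?case
  proof (cases "a = b")
    case True
    then show ?thesis using 1 a by simp
  next
    case False
    then have ne: "child o' p a \<noteq> child o' p b"
      using bij_child[of o' p] 1 unfolding bij_betw_def inj_on_def by auto
    obtain zs where zs: "nb_walk E (p # child o' p a # zs)"
      "last (child o' p a # zs) = descend p (child o' p a) x" "length zs = length x"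
      using descend_nb_walk[OF a, of x] 1 by auto
    obtain us where us: "nb_walk E (p # child o' p b # us)"
      "last (child o' p b # us) = descend p (child o' p b) y" "length us = length y"
      using descend_nb_walk[OF b, of y] 1 by auto
    have "hd (rev (child o' p a # zs) @ p # child o' p b # us) = last (child o' p a # zs)"
      by (metis hd_append2 hd_rev list.distinct(1) rev_is_Nil_conv)
    then show ?thesis
      using graph_dist_nb_walk[OF nb_walk_join[OF edge_sym zs(1) us(1) ne]] zs us False by auto
  qed
next
  case ("2_1" y)
  obtain zs where zs: "nb_walk E (o' # p # zs)" "last (p # zs) = descend o' p y"
      "length zs = length y"
    using descend_nb_walk "2_1" by blast
  from graph_dist_nb_walk[OF nb_walk_tl[OF zs(1)] _ zs(2)] zs(3) show ?case by simp
next
  case ("2_2" x)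
  obtain zs where "nb_walk E (o' # p # zs)" "last (p # zs) = descend o' p x" "length zs = length x"
    using descend_nb_walk "2_2" by blast
  then have zs: "nb_walk E (p # zs)" "last (p # zs) = descend o' p x" "length zs = length x"
    using nb_walk_tl by auto
  have "hd (rev (p # zs)) = descend o' p x" "last (rev (p # zs)) = p"
    using zs(2) by (simp_all only: hd_rev last_rev list.sel)
  from graph_dist_nb_walk[OF nb_walk_rev[OF edge_sym zs(1)] this] zs(3) show ?case by simp
qed

lemma word_dist_eq_0: "word_dist x y = 0 \<Longrightarrow> x = y"
  by (induction x y rule: word_dist.induct) (auto split: if_splits)

context tree
begin

lemma ex_edge: "\<exists>y. E x y"
  using card_neighbours[of x] by (metis Collect_empty_eq card.empty Suc_eq_plus1 nat.distinct(1))

text \<open>The vertices beyond a single oriented edge form an isometric copy of the rooted tree,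
  which will carry the test matrices of the lower bound.\<close>

lemma ex_isometric_words:
  "\<exists>f. inj_on f (lists {..<q}) \<and>
    (\<forall>x\<in>lists {..<q}. \<forall>y\<in>lists {..<q}. graph_dist E (f x) (f y) = word_dist x y)"
proof -
  obtain o' p where op: "E o' p" using ex_edge by blast
  have "inj_on (descend o' p) (lists {..<q})"
  proof (rule inj_onI)
    fix x y assume xy: "x \<in> lists {..<q}" "y \<in> lists {..<q}" "descend o' p x = descend o' p y"
    have "graph_dist E (descend o' p x) (descend o' p y) = 0"
      using graph_dist_nb_walk[of "[descend o' p x]"] xy(3) by simp
    then have "word_dist x y = 0" using graph_dist_descend[OF op xy(1,2)] by simp
    then show "x = y" by (rule word_dist_eq_0)
  qed
  then show ?thesis using graph_dist_descend[OF op] by blast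
qed

text \<open>The root is placed so far away that all of \<open>F\<close> lies beyond one oriented
  edge; the coordinates depend on \<open>F\<close>.\<close>

lemma ex_words_of_finite:
  assumes "finite F"
  shows "\<exists>f. (\<forall>x\<in>F. f x \<in> lists {..<q}) \<and>
    (\<forall>x\<in>F. \<forall>y\<in>F. graph_dist E x y = word_dist (f x) (f y))"
proof -
  obtain x0 e where e: "E e x0" using ex_edge by blast
  \<comment> \<open>\<open>M\<close> exceeds every distance from \<open>F\<close> to
    \<open>x0\<close>. The \<open>0\<close> covers empty \<open>F\<close>, and \<open>Suc\<close>
    makes the path below long enough to contain an edge.\<close>
  define M where "M = Suc (Max (insert 0 ((\<lambda>x. graph_dist E x x0) ` F)))"
  have M: "graph_dist E x x0 < M" if "x \<in> F" for x
    unfolding M_def less_Suc_eq_le using assms that by (intro Max_ge) auto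
  have "replicate M 0 \<in> lists {..<q}" using q_ge_2 by auto
  from descend_nb_walk[OF e this] obtain zs where zs: "nb_walk E (e # x0 # zs)" "length zs = M"
    by auto
  have nb_rev: "nb_walk E (rev (x0 # zs))"
    by (rule nb_walk_rev[OF edge_sym nb_walk_tl[OF zs(1)]])
  have "length (rev (x0 # zs)) = Suc (Suc (M - 1))" using zs(2) M_def by simp
  then obtain o' p rest where r: "rev (x0 # zs) = o' # p # rest"
    unfolding length_Suc_conv by blast
  have nb: "nb_walk E (o' # p # rest)" using nb_rev unfolding r .
  have len: "length (p # rest) = M" and last: "last (p # rest) = x0"
    using arg_cong[OF r, of length] arg_cong[OF r, of last] zs(2)
    by (simp_all add: last_rev split: if_splits)
  have op: "E o' p" using nb by (cases rest) auto
  \<comment> \<open>A vertex not beyond the edge from \<open>o'\<close> to \<open>p\<close> is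
    joined to \<open>x0\<close> by a geodesic through \<open>o'\<close>, which is at distance
    \<open>M\<close> from \<open>x0\<close>. That is too long for a member of
    \<open>F\<close>.\<close>
  have "\<exists>w\<in>lists {..<q}. descend o' p w = x" if "x \<in> F" for x
  proof -
    obtain ys where ys: "nb_walk E (o' # ys)" "last (o' # ys) = x" using ex_nb_walk by blast
    show ?thesis
    proof (cases ys)
      case Nil
      then have "graph_dist E x x0 = M"
        using graph_dist_nb_walk[OF nb, of x x0] ys last len by auto
      then show ?thesis using M[OF that] by simp
    next
      case (Cons y us)
      show ?thesis
      proof (cases "y = p")
        case True
        then show ?thesis using nb_walk_descend[of o' p us] ys Cons by auto
      next
        case False
        have "nb_walk E (rev (y # us) @ o' # p # rest)"
          using nb_walk_join[OF edge_sym _ nb False] ys(1) Cons by auto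
        moreover have "hd (rev (y # us) @ o' # p # rest) = x"
          using ys(2) Cons by (metis hd_append2 hd_rev last.simps list.distinct(1) rev_is_Nil_conv)
        ultimately have "graph_dist E x x0 = length (rev (y # us) @ o' # p # rest) - 1"
          using graph_dist_nb_walk last by auto
        then show ?thesis using M[OF that] len by simp
      qed
    qed
  qed
  then obtain f where "\<forall>x\<in>F. f x \<in> lists {..<q} \<and> descend o' p (f x) = x" by metis
  then show ?thesis using graph_dist_descend[OF op] by (intro exI[of _ f]) metis
qed

end

section \<open>The spherical kernel as a Gram matrix\<close>

context arity
begin

section \<open>Spheres and balls of words, and the recursion of sums over them\<close>

definition W :: "nat \<Rightarrow> nat list set" where
  "W n = {w \<in> lists {..<q}. length w = n}"

definition V :: "nat \<Rightarrow> nat list set" where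
  "V n = {w \<in> lists {..<q}. length w < n}"

lemma W_0 [simp]: "W 0 = {[]}"
  by (auto simp: W_def)

lemma finite_W [simp]: "finite (W n)"
  using finite_lists_length_eq[of "{..<q}" n] by (simp add: W_def lists_eq_set)

lemma card_W: "card (W n) = q ^ n"
  using card_lists_length_eq[of "{..<q}" n] by (simp add: W_def lists_eq_set)

lemma V_eq_UN_W: "V n = (\<Union>p<n. W p)"
  by (auto simp: V_def W_def)

lemma finite_V [simp]: "finite (V n)"
  by (simp add: V_eq_UN_W)

lemma sum_V: "(\<Sum>v\<in>V n. f v) = (\<Sum>p<n. \<Sum>v\<in>W p. f v)"
  unfolding V_eq_UN_W by (rule sum.UNION_disjoint) (simp_all, auto simp: W_def)

lemma sum_W_Suc: "(\<Sum>x\<in>W (Suc n). f x) = (\<Sum>b<q. \<Sum>t\<in>W n. f (b # t))"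
proof -
  have "W (Suc n) = (\<lambda>(b, t). b # t) ` ({..<q} \<times> W n)"
    by (auto simp: W_def length_Suc_conv)
  moreover have "inj_on (\<lambda>(b, t). b # t) ({..<q} \<times> W n)" by (auto simp: inj_on_def)
  ultimately show ?thesis
    by (simp add: sum.reindex sum.cartesian_product case_prod_unfold)
qed

lemma sum_V_Suc: "(\<Sum>x\<in>V (Suc n). f x) = f [] + (\<Sum>b<q. \<Sum>t\<in>V n. f (b # t))"
  unfolding sum_V sum.lessThan_Suc_shift
  by (simp add: sum_W_Suc sum.swap[of _ "{..<q}"])

text \<open>The matrix of the orthogonal projection in dimension \<open>q\<close> onto the
  complement of the constants.\<close>

definition centering :: "nat \<Rightarrow> nat \<Rightarrow> complex" where
  "centering a b = (if a = b then 1 else 0) - 1 / of_nat q"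

lemma centering_commute: "centering a b = centering b a"
  by (simp add: centering_def)

lemma cnj_centering [simp]: "cnj (centering a b) = centering a b"
  by (simp add: centering_def)

lemma q_ne_0 [simp]: "q \<noteq> 0" "(of_nat q :: complex) \<noteq> 0" "0 < q"
  using q_ge_2 by auto

lemma sum_centering: "b < q \<Longrightarrow> (\<Sum>a<q. centering a b) = 0"
  by (simp add: centering_def sum_subtractf)

text \<open>Idempotence of this symmetric projection.\<close>

lemma sum_centering_mult:
  assumes "b < q" "c < q"
  shows "(\<Sum>a<q. centering a b * centering a c) = centering b c"
proof -
  have "(\<Sum>a<q. centering a b * centering a c) =
      (\<Sum>a<q. if a = b then centering a c else 0) - (\<Sum>a<q. centering a c) / of_nat q"
    unfolding sum_divide_distrib sum_subtractf[symmetric]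
    by (rule sum.cong) (auto simp: centering_def algebra_simps diff_divide_distrib)
  also have "\<dots> = centering b c" using assms sum_centering by simp
  finally show ?thesis .
qed

text \<open>The coordinate \<open>(v, a)\<close> belongs to the vertex \<open>v @ [a]\<close>. It is nonzero only for proper prefixes
  \<open>v\<close> of \<open>x = v @ b # t\<close>, where \<open>v @ [b]\<close> is the ancestor of \<open>x\<close> at distance \<open>length t\<close>.\<close>

fun coef :: "(nat \<Rightarrow> complex) \<Rightarrow> nat list \<Rightarrow> nat list \<Rightarrow> nat \<Rightarrow> complex" where
  "coef k [] v a = 0"
| "coef k (b # t) [] a = k (length t) * centering a b"
| "coef k (b # t) (c # v) a = (if b = c then coef k t v a else 0)"

lemma coef_eq_0: "length x \<le> length v \<Longrightarrow> coef k x v a = 0"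
  by (induction k x v a rule: coef.induct) auto

lemma cnj_coef: "cnj (coef k x v a) = coef (\<lambda>i. cnj (k i)) x v a"
  by (induction k x v a rule: coef.induct) auto

text \<open>The pairing is bilinear; conjugates enter only through the choice of \<open>k'\<close>.
  The cutoff \<open>L\<close> makes the sum finite and has no effect once it reaches the length of
  one of the words.\<close>

definition gram :: "(nat \<Rightarrow> complex) \<Rightarrow> (nat \<Rightarrow> complex) \<Rightarrow> nat \<Rightarrow> nat list \<Rightarrow> nat list \<Rightarrow> complex" where
  "gram k k' L x y = (\<Sum>v\<in>V L. \<Sum>a<q. coef k x v a * coef k' y v a)"

text \<open>The empty word has no proper prefix, so all its coordinates vanish.\<close>

lemma gram_Nil [simp]: "gram k k' L [] y = 0" "gram k k' L x [] = 0"
  by (simp_all add: gram_def)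

lemma gram_Cons:
  assumes "a < q" "b < q"
  shows "gram k k' (Suc L) (a # x) (b # y) =
    k (length x) * k' (length y) * centering a b + (if a = b then gram k k' L x y else 0)"
proof -
  \<comment> \<open>The sum over prefixes splits into the empty prefix, evaluated by idempotence,
    and the prefixes \<open>c # v\<close>, which matter only for \<open>c = a = b\<close>. The
    recursion thus follows that of \<open>word_dist\<close>.\<close>
  have "(\<Sum>e<q. coef k (a # x) [] e * coef k' (b # y) [] e) =
      k (length x) * k' (length y) * (\<Sum>e<q. centering e a * centering e b)"
    by (simp add: sum_distrib_left algebra_simps)
  moreover have "(\<Sum>c<q. \<Sum>v\<in>V L. \<Sum>e<q. coef k (a # x) (c # v) e * coef k' (b # y) (c # v) e) =
      (\<Sum>c<q. if c = a then (if a = b then gram k k' L x y else 0) else 0)"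
    by (rule sum.cong) (auto simp: gram_def)
  ultimately show ?thesis
    using assms unfolding gram_def[of k k' "Suc L"] sum_V_Suc
    by (simp add: sum_centering_mult)
qed

text \<open>Each proper prefix contributes one weight times the diagonal entry
  \<open>1 - 1 / q\<close> of the projection.\<close>

lemma gram_self:
  assumes "x \<in> lists {..<q}" "length x \<le> L"
  shows "gram k (\<lambda>i. cnj (k i)) L x x =
    of_real ((1 - 1 / real q) * (\<Sum>i<length x. (cmod (k i))\<^sup>2))"
  using assms
proof (induction x arbitrary: L)
  case (Cons a x)
  then obtain L' where L: "L = Suc L'" by (cases L) auto
  have "k (length x) * cnj (k (length x)) = of_real ((cmod (k (length x)))\<^sup>2)"
    by (simp only: complex_norm_square)
  then show ?case using Cons unfolding L
    by (simp add: gram_Cons centering_def algebra_simps)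
qed simp

lemma sum_norm_coef:
  assumes "x \<in> lists {..<q}" "length x \<le> L"
  shows "(\<Sum>v\<in>V L. \<Sum>a<q. (cmod (coef k x v a))\<^sup>2) =
    (1 - 1 / real q) * (\<Sum>i<length x. (cmod (k i))\<^sup>2)"
proof -
  have "complex_of_real (\<Sum>v\<in>V L. \<Sum>a<q. (cmod (coef k x v a))\<^sup>2) = gram k (\<lambda>i. cnj (k i)) L x x"
    unfolding gram_def of_real_sum by (simp only: complex_norm_square cnj_coef)
  then show ?thesis using gram_self[OF assms] by (simp only: of_real_eq_iff)
qed

end

section \<open>The recurrences behind the spherical functions\<close>

locale spherical = arity +
  fixes \<alpha> \<beta> :: complex
  assumes prod_eq: "\<alpha> * \<beta> = 1 / of_nat q"
begin

text \<open>The quotient of \<open>\<alpha> ^ Suc n - \<beta> ^ Suc n\<close> by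
  \<open>\<alpha> - \<beta>\<close>, in a form that also covers
  \<open>\<alpha> = \<beta>\<close>.\<close>

definition U :: "nat \<Rightarrow> complex" where
  "U n = (\<Sum>k\<le>n. \<alpha> ^ k * \<beta> ^ (n - k))"

lemma U_0 [simp]: "U 0 = 1"
  by (simp add: U_def)

lemma U_Suc: "U (Suc n) = \<alpha> * U n + \<beta> ^ Suc n"
  unfolding U_def sum.atMost_Suc_shift by (simp add: sum_distrib_left mult.assoc)

lemma U_rec: "U (Suc (Suc n)) = (\<alpha> + \<beta>) * U (Suc n) - U n / of_nat q"
proof -
  have "U (Suc (Suc n)) = \<alpha> * U (Suc n) + \<beta> * (U (Suc n) - \<alpha> * U n)"
    unfolding U_Suc[of "Suc n"] by (simp add: U_Suc)
  also have "\<dots> = (\<alpha> + \<beta>) * U (Suc n) - (\<alpha> * \<beta>) * U n" by (simp add: algebra_simps)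
  finally show ?thesis by (simp add: prod_eq)
qed

text \<open>By the recurrence the left side depends on \<open>l + m\<close> only: a unit can be
  moved from \<open>m\<close> to \<open>l\<close>, down to \<open>m = 0\<close>.\<close>

lemma U_mult: "U (Suc l) * U (Suc m) - U l * U m / of_nat q = U (l + m + 2)"
proof (induction m arbitrary: l)
  case 0 then show ?case using U_rec[of l] U_Suc[of 0] by (simp add: algebra_simps)
next
  case (Suc m)
  have "U (Suc l) * U (Suc (Suc m)) - U l * U (Suc m) / of_nat q =
      U (Suc (Suc l)) * U (Suc m) - U (Suc l) * U m / of_nat q"
    unfolding U_rec[of l] U_rec[of m] by (simp add: algebra_simps)
  then show ?case using Suc.IH[of "Suc l"] by simp
qed

text \<open>All clauses are the last one, continued by \<open>U (-1) = 0\<close> and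
  \<open>U (-2) = - q\<close>. Expressing the spherical function through \<open>U\<close> avoids the
  denominator \<open>\<alpha> - \<beta>\<close>.\<close>

fun \<Phi> :: "nat \<Rightarrow> complex" where
  "\<Phi> 0 = 1"
| "\<Phi> (Suc 0) = of_nat q / (of_nat q + 1) * (\<alpha> + \<beta>)"
| "\<Phi> (Suc (Suc n)) = (of_nat q * U (Suc (Suc n)) - U n / of_nat q) / (of_nat q + 1)"

definition C :: complex where
  "C = of_nat q * (1 - \<alpha>\<^sup>2) * (1 - \<beta>\<^sup>2) / (of_nat q + 1)"

lemma \<Phi>_diff: "\<Phi> n - \<Phi> (Suc (Suc n)) = C * U n"
proof -
  have q1: "(of_nat q + 1 :: complex) \<noteq> 0" by (metis of_nat_Suc of_nat_neq_0 add.commute)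
  \<comment> \<open>In the symmetric functions \<open>s\<close> and \<open>r\<close> the claim
    becomes a polynomial identity modulo \<open>q * r = 1\<close>.\<close>
  define s where "s = \<alpha> + \<beta>"
  define r where "r = 1 / (of_nat q :: complex)"
  have r: "\<alpha> * \<beta> = r" "of_nat q * r = 1" by (simp_all add: r_def prod_eq)
  have rec: "U (Suc (Suc k)) = s * U (Suc k) - r * U k" for k
    by (simp add: U_rec s_def r_def)
  have sq: "(1 - \<alpha>\<^sup>2) * (1 - \<beta>\<^sup>2) = 1 + 2 * r + r\<^sup>2 - s\<^sup>2"
    unfolding r(1)[symmetric] s_def by (simp add: power2_eq_square algebra_simps)
  have U1: "U (Suc 0) = s" by (simp add: U_Suc s_def)
  have \<Phi>_SS: "(of_nat q + 1) * \<Phi> (Suc (Suc k)) = of_nat q * U (Suc (Suc k)) - r * U k" for k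
    using q1 by (simp add: r_def)
  have key: "(of_nat q + 1) * \<Phi> n - (of_nat q + 1) * \<Phi> (Suc (Suc n)) =
      of_nat q * (1 + 2 * r + r\<^sup>2 - s\<^sup>2) * U n"
  proof (cases n rule: \<Phi>.cases)
    case 1
    have "of_nat q * r\<^sup>2 = r" using r(2) by (simp add: power2_eq_square mult.assoc[symmetric])
    then show ?thesis unfolding \<Phi>_SS rec 1 U1 U_0 \<Phi>.simps(1) using r(2)
      by (simp add: algebra_simps power2_eq_square)
  next
    case 2
    have "(of_nat q + 1) * \<Phi> (Suc 0) = of_nat q * s" using q1 by (simp add: s_def)
    then show ?thesis unfolding \<Phi>_SS rec 2 U1 U_0 using r(2) by algebra
  next
    case (3 m)
    show ?thesis unfolding \<Phi>_SS rec 3 using r(2) by algebra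
  qed
  have "(of_nat q + 1) * (C * U n) = of_nat q * (1 + 2 * r + r\<^sup>2 - s\<^sup>2) * U n"
    unfolding C_def using q1 sq[symmetric] by simp
  then show ?thesis using key q1 by (metis mult_left_cancel right_diff_distrib)
qed

text \<open>The part of the kernel that depends on the lengths only. Its second summand cancels the
  contribution of the entry \<open>- 1 / q\<close> of the projection at the point where two words
  part.\<close>

definition boundary :: "nat \<Rightarrow> nat \<Rightarrow> complex" where
  "boundary l m = \<Phi> (l + m) +
    C / of_nat q * (if l = 0 \<or> m = 0 then 0 else U (l - 1) * U (m - 1))"

text \<open>\<open>U_mult\<close> rewrites \<open>U (l + m)\<close> in \<open>\<Phi>_diff\<close>
  through products. The resulting rank one term is what a common first letter adds to the Gram
  matrix.\<close>

lemma boundary_Suc: "boundary l m - boundary (Suc l) (Suc m) = C * (1 - 1 / of_nat q) * (U l * U m)"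
proof -
  have "U l * U m - (if l = 0 \<or> m = 0 then 0 else U (l - 1) * U (m - 1)) / of_nat q = U (l + m)"
    using U_mult[of "l - 1" "m - 1"] by (cases l; cases m) simp_all
  then have "\<Phi> (l + m) - \<Phi> (Suc (Suc (l + m))) =
      C * (U l * U m - (if l = 0 \<or> m = 0 then 0 else U (l - 1) * U (m - 1)) / of_nat q)"
    by (simp add: \<Phi>_diff del: \<Phi>.simps)
  then show ?thesis unfolding boundary_def by (simp add: algebra_simps del: \<Phi>.simps)
qed

text \<open>Induction along the common prefix: \<open>boundary_Suc\<close> accounts for each common
  letter, and the definition of \<open>boundary\<close> for the first difference.\<close>

lemma \<Phi>_word_dist:
  "x \<in> lists {..<q} \<Longrightarrow> y \<in> lists {..<q} \<Longrightarrow> min (length x) (length y) \<le> L \<Longrightarrow>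
    \<Phi> (word_dist x y) = C * gram U U L x y + boundary (length x) (length y)"
proof (induction x y arbitrary: L rule: word_dist.induct)
  case (1 a x b y)
  then obtain L' where L: "L = Suc L'" by (cases L) auto
  show ?case
  proof (cases "a = b")
    case True
    then have "\<Phi> (word_dist x y) = C * gram U U L' x y + boundary (length x) (length y)"
      using 1 L by simp
    then show ?thesis using True 1 boundary_Suc[of "length x" "length y"] unfolding L
      by (simp add: gram_Cons centering_def algebra_simps del: \<Phi>.simps)
  next
    case False
    then show ?thesis using 1 unfolding L
      by (simp add: gram_Cons centering_def boundary_def del: \<Phi>.simps)
  qed
qed (simp_all add: boundary_def)

end

section \<open>Upper bound\<close>

lemma form_valuesI:
  "finite F \<Longrightarrow> (\<Sum>x\<in>F. (cmod (u x))\<^sup>2) \<le> 1 \<Longrightarrow> (\<Sum>x\<in>F. (cmod (v x))\<^sup>2) \<le> 1 \<Longrightarrow>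
    cmod (\<Sum>x\<in>F. \<Sum>y\<in>F. u x * A x y * v y) \<in> form_values A"
  unfolding form_values_def by blast

lemma form_valuesE:
  assumes "t \<in> form_values A"
  obtains F u v where "finite F" "(\<Sum>x\<in>F. (cmod (u x))\<^sup>2) \<le> 1" "(\<Sum>x\<in>F. (cmod (v x))\<^sup>2) \<le> 1"
    "t = cmod (\<Sum>x\<in>F. \<Sum>y\<in>F. u x * A x y * v y)"
  using assms unfolding form_values_def mem_Collect_eq by (elim exE conjE)

text \<open>Homogeneity. Vectors of norm zero cannot be normalized and are treated apart.\<close>

lemma form_values_scaled:
  assumes bound: "\<And>t. t \<in> form_values A \<Longrightarrow> t \<le> B" and F: "finite F"
  shows "cmod (\<Sum>x\<in>F. \<Sum>y\<in>F. u x * A x y * v y) \<le>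
    B * L2_set (\<lambda>x. cmod (u x)) F * L2_set (\<lambda>x. cmod (v x)) F"
proof -
  define a b where "a = L2_set (\<lambda>x. cmod (u x)) F" and "b = L2_set (\<lambda>x. cmod (v x)) F"
  show ?thesis
  proof (cases "a = 0 \<or> b = 0")
    case True
    then have "(\<forall>x\<in>F. u x = 0) \<or> (\<forall>x\<in>F. v x = 0)"
      using F by (simp add: a_def b_def L2_set_eq_0_iff)
    then have "(\<Sum>x\<in>F. \<Sum>y\<in>F. u x * A x y * v y) = 0"
      by (auto intro!: sum.neutral)
    then show ?thesis using True by (auto simp: a_def b_def)
  next
    case False
    then have pos: "a > 0" "b > 0" by (auto simp: a_def b_def less_le L2_set_nonneg)
    have unit: "(\<Sum>x\<in>F. (cmod (w x / of_real c))\<^sup>2) \<le> 1"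
      if "c = L2_set (\<lambda>x. cmod (w x)) F" "c > 0" for w :: "'a \<Rightarrow> complex" and c
    proof -
      have "(\<Sum>x\<in>F. (cmod (w x))\<^sup>2) = c\<^sup>2"
        by (simp add: that(1) L2_set_def sum_nonneg)
      then show ?thesis using that(2)
        by (simp add: norm_divide power_divide flip: sum_divide_distrib)
    qed
    have "cmod (\<Sum>x\<in>F. \<Sum>y\<in>F. (u x / of_real a) * A x y * (v y / of_real b)) \<le> B"
      by (rule bound) (use unit[OF a_def] unit[OF b_def] pos F in \<open>intro form_valuesI, auto\<close>)
    moreover have "(\<Sum>x\<in>F. \<Sum>y\<in>F. (u x / of_real a) * A x y * (v y / of_real b)) =
        (\<Sum>x\<in>F. \<Sum>y\<in>F. u x * A x y * v y) / of_real (a * b)"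
      unfolding sum_divide_distrib by (intro sum.cong refl) simp
    ultimately have "cmod (\<Sum>x\<in>F. \<Sum>y\<in>F. u x * A x y * v y) / (a * b) \<le> B"
      using pos by (simp add: norm_divide norm_mult)
    then show ?thesis using pos by (simp add: a_def[symmetric] b_def[symmetric] field_simps)
  qed
qed

text \<open>The easy half of the Grothendieck criterion for Schur multipliers: the form splits into
  forms of \<open>A\<close> on the vectors \<open>u * P j\<close> and \<open>v * Q j\<close>, and
  Cauchy-Schwarz over \<open>j\<close> bounds their sum.\<close>

lemma schur_factorization_bound:
  assumes bound: "\<And>t. t \<in> form_values A \<Longrightarrow> t \<le> B" and "0 \<le> B" "0 \<le> M" "finite F"
    and P: "\<And>x. x \<in> F \<Longrightarrow> (\<Sum>j\<in>J. (cmod (P x j))\<^sup>2) \<le> M"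
    and Q: "\<And>x. x \<in> F \<Longrightarrow> (\<Sum>j\<in>J. (cmod (Q x j))\<^sup>2) \<le> M"
    and u: "(\<Sum>x\<in>F. (cmod (u x))\<^sup>2) \<le> 1" and v: "(\<Sum>x\<in>F. (cmod (v x))\<^sup>2) \<le> 1"
  shows "cmod (\<Sum>x\<in>F. \<Sum>y\<in>F. u x * ((\<Sum>j\<in>J. P x j * Q y j) * A x y) * v y) \<le> M * B"
proof -
  define N where "N w = L2_set (\<lambda>x. cmod (w x)) F" for w :: "'a \<Rightarrow> complex"
  \<comment> \<open>Exchanging the sums over \<open>j\<close> and \<open>x\<close> bounds the total
    squared norm of the split vectors by \<open>M\<close>.\<close>
  have NN: "L2_set (\<lambda>j. N (\<lambda>x. w x * R x j)) J \<le> sqrt M"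
    if "(\<Sum>x\<in>F. (cmod (w x))\<^sup>2) \<le> 1" "\<And>x. x \<in> F \<Longrightarrow> (\<Sum>j\<in>J. (cmod (R x j))\<^sup>2) \<le> M"
    for w and R :: "'a \<Rightarrow> 'b \<Rightarrow> complex"
  proof -
    have "(\<Sum>j\<in>J. (N (\<lambda>x. w x * R x j))\<^sup>2) = (\<Sum>j\<in>J. \<Sum>x\<in>F. (cmod (w x))\<^sup>2 * (cmod (R x j))\<^sup>2)"
      by (simp add: N_def L2_set_def sum_nonneg norm_mult power_mult_distrib)
    also have "\<dots> = (\<Sum>x\<in>F. (cmod (w x))\<^sup>2 * (\<Sum>j\<in>J. (cmod (R x j))\<^sup>2))"
      by (subst sum.swap) (simp add: sum_distrib_left)
    also have "\<dots> \<le> (\<Sum>x\<in>F. (cmod (w x))\<^sup>2 * M)"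
      by (intro sum_mono mult_left_mono that) auto
    also have "\<dots> \<le> 1 * M"
      unfolding sum_distrib_right[symmetric] by (intro mult_right_mono that \<open>0 \<le> M\<close>)
    finally show ?thesis by (simp add: L2_set_def)
  qed
  have "(\<Sum>x\<in>F. \<Sum>y\<in>F. u x * ((\<Sum>j\<in>J. P x j * Q y j) * A x y) * v y) =
      (\<Sum>x\<in>F. \<Sum>y\<in>F. \<Sum>j\<in>J. (u x * P x j) * A x y * (v y * Q y j))"
    by (intro sum.cong refl) (simp add: sum_distrib_left sum_distrib_right algebra_simps)
  also have "\<dots> = (\<Sum>x\<in>F. \<Sum>j\<in>J. \<Sum>y\<in>F. (u x * P x j) * A x y * (v y * Q y j))"
    by (intro sum.cong refl sum.swap)
  also have "\<dots> = (\<Sum>j\<in>J. \<Sum>x\<in>F. \<Sum>y\<in>F. (u x * P x j) * A x y * (v y * Q y j))"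
    by (rule sum.swap)
  finally have "cmod (\<Sum>x\<in>F. \<Sum>y\<in>F. u x * ((\<Sum>j\<in>J. P x j * Q y j) * A x y) * v y) \<le>
      (\<Sum>j\<in>J. cmod (\<Sum>x\<in>F. \<Sum>y\<in>F. (u x * P x j) * A x y * (v y * Q y j)))"
    by (simp add: norm_sum)
  also have "\<dots> \<le> (\<Sum>j\<in>J. B * N (\<lambda>x. u x * P x j) * N (\<lambda>y. v y * Q y j))"
    unfolding N_def by (intro sum_mono form_values_scaled bound \<open>finite F\<close>)
  also have "\<dots> = B * (\<Sum>j\<in>J. \<bar>N (\<lambda>x. u x * P x j)\<bar> * \<bar>N (\<lambda>y. v y * Q y j)\<bar>)"
    by (simp add: sum_distrib_left N_def mult.assoc)
  also have "\<dots> \<le> B * (sqrt M * sqrt M)"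
    using NN[of u P, OF u P] NN[of v Q, OF v Q] \<open>0 \<le> M\<close>
    by (intro mult_left_mono \<open>0 \<le> B\<close> order.trans[OF L2_set_mult_ineq] mult_mono) auto
  finally show ?thesis using \<open>0 \<le> M\<close> by (simp add: mult.commute)
qed

section \<open>Decay and square sum of \<open>U\<close> inside the strip\<close>

context spherical
begin

context
  assumes \<alpha>: "cmod \<alpha> < 1" and \<beta>: "cmod \<beta> < 1"
begin

text \<open>The norms are dominated by the Cauchy product of two geometric series.\<close>

lemma summable_norm_U: "summable (\<lambda>n. cmod (U n))"
proof (rule summable_comparison_test)
  show "\<exists>N. \<forall>n\<ge>N. norm (cmod (U n)) \<le> (\<Sum>k\<le>n. cmod \<alpha> ^ k * cmod \<beta> ^ (n - k))"
    unfolding U_def by (auto intro!: sum_norm_le simp: norm_mult norm_power)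
  show "summable (\<lambda>n. \<Sum>k\<le>n. cmod \<alpha> ^ k * cmod \<beta> ^ (n - k))"
    by (rule summable_Cauchy_product) (use \<alpha> \<beta> in \<open>simp_all add: norm_power\<close>)
qed

lemma U_tendsto_0: "U \<longlonglongrightarrow> 0"
  using summable_LIMSEQ_zero[OF summable_norm_U] by (rule tendsto_norm_zero_cancel)

lemma summable_U_mult:
  assumes "\<And>n. cmod (f n) \<le> K"
  shows "summable (\<lambda>n. U n * f n)"
proof (rule summable_comparison_test)
  show "\<exists>N. \<forall>n\<ge>N. norm (U n * f n) \<le> cmod (U n) * K"
    using assms by (auto simp: norm_mult mult_left_mono)
  show "summable (\<lambda>n. cmod (U n) * K)" by (rule summable_mult2) (rule summable_norm_U)
qed

text \<open>Inserting \<open>U_Suc\<close> into the shifted series gives a linear equation for the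
  sum \<open>a\<close>. It involves the mixed sum \<open>b\<close>, which satisfies a linear
  equation of the same kind.\<close>

lemma sums_U_sq:
  "(\<lambda>n. (cmod (U n))\<^sup>2) sums
    ((1 - 1 / (real q)\<^sup>2) / ((1 - (cmod \<alpha>)\<^sup>2) * (1 - (cmod \<beta>)\<^sup>2) * (cmod (1 - \<alpha> * cnj \<beta>))\<^sup>2))"
proof -
  define t where "t = \<alpha> * cnj \<beta>"
  define a where "a = (\<Sum>n. U n * cnj (U n))"
  define b where "b = (\<Sum>n. U n * cnj \<beta> ^ n)"
  define d where "d = \<beta> * cnj \<beta>"
  obtain K where K: "cmod (U n) \<le> K" for n
    using U_tendsto_0 Bseq_def convergent_imp_Bseq convergentI by blast
  have suma: "(\<lambda>n. U n * cnj (U n)) sums a"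
    unfolding a_def using summable_U_mult[of "\<lambda>n. cnj (U n)" K] K by (simp add: summable_sums)
  have sumb: "(\<lambda>n. U n * cnj \<beta> ^ n) sums b"
    unfolding b_def using summable_U_mult[of "\<lambda>n. cnj \<beta> ^ n" 1] \<beta>
    by (simp add: summable_sums norm_power power_le_one)
  have lt1: "cmod (z * cnj w) < 1" if "cmod z < 1" "cmod w < 1" for z w
    using mult_strict_mono[OF that] by (simp add: norm_mult)
  have d: "cmod d < 1" using lt1[OF \<beta> \<beta>] by (simp add: d_def)
  then have sumd: "(\<lambda>n. d ^ n) sums (1 / (1 - d))" by (rule geometric_sums)
  have t: "cmod t < 1" using lt1[OF \<alpha> \<beta>] by (simp add: t_def)
  have "(\<lambda>n. t * (U n * cnj \<beta> ^ n) + d * d ^ n) sums (t * b + d * (1 / (1 - d)))"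
    by (intro sums_add sums_mult sumb sumd)
  moreover have "t * (U n * cnj \<beta> ^ n) + d * d ^ n = U (Suc n) * cnj \<beta> ^ Suc n" for n
    unfolding t_def d_def U_Suc by (simp add: power_mult_distrib algebra_simps)
  moreover have "(\<lambda>n. U (Suc n) * cnj \<beta> ^ Suc n) sums (b - 1)"
    using sumb by (subst sums_Suc_iff) simp
  ultimately have b: "b - 1 = t * b + d * (1 / (1 - d))"
    using sums_unique2 by auto
  have sumbc: "(\<lambda>n. cnj (U n * cnj \<beta> ^ n)) sums cnj b"
    using sumb by (simp only: sums_cnj)
  have "(\<lambda>n. \<alpha> * cnj \<alpha> * (U n * cnj (U n)) + t * (U n * cnj \<beta> ^ n)
        + cnj t * cnj (U n * cnj \<beta> ^ n) + d * d ^ n) sums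
      (\<alpha> * cnj \<alpha> * a + t * b + cnj t * cnj b + d * (1 / (1 - d)))"
    by (intro sums_add sums_mult suma sumb sumbc sumd)
  moreover have "\<alpha> * cnj \<alpha> * (U n * cnj (U n)) + t * (U n * cnj \<beta> ^ n)
        + cnj t * cnj (U n * cnj \<beta> ^ n) + d * d ^ n = U (Suc n) * cnj (U (Suc n))" for n
    unfolding t_def d_def U_Suc by (simp add: power_mult_distrib algebra_simps)
  moreover have "(\<lambda>n. U (Suc n) * cnj (U (Suc n))) sums (a - 1)"
    using suma by (subst sums_Suc_iff) simp
  ultimately have a: "a - 1 = \<alpha> * cnj \<alpha> * a + t * b + cnj t * cnj b + d * (1 / (1 - d))"
    using sums_unique2 by auto
  have ne: "1 - t \<noteq> 0" "1 - cnj t \<noteq> 0" "1 - d \<noteq> 0" "1 - \<alpha> * cnj \<alpha> \<noteq> 0"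
  proof -
    show "1 - t \<noteq> 0" "1 - d \<noteq> 0" using t d by auto
    then show "1 - cnj t \<noteq> 0" by (metis complex_cnj_diff complex_cnj_one complex_cnj_zero_iff)
    have "cmod (\<alpha> * cnj \<alpha>) < 1" using lt1[OF \<alpha> \<alpha>] by simp
    then show "1 - \<alpha> * cnj \<alpha> \<noteq> 0" by auto
  qed
  have cd: "cnj d = d" by (simp add: d_def)
  have b': "b * (1 - t) * (1 - d) = 1" using b ne(3) by (simp add: field_simps)
  define w where "w = 1 / (1 - d)"
  have w: "w * (1 - d) = 1" "1 + d * (1 / (1 - d)) = w" using ne by (simp_all add: w_def field_simps)
  have bc: "cnj b * (1 - cnj t) * (1 - d) = 1"
    using arg_cong[OF b', of cnj] by (simp add: cd)
  have "a * (1 - \<alpha> * cnj \<alpha>) = t * b + cnj t * cnj b + w"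
    unfolding w(2)[symmetric] using a by algebra
  then have "a * (1 - \<alpha> * cnj \<alpha>) * (1 - d) * ((1 - t) * (1 - cnj t)) = 1 - t * cnj t"
    using b' bc w(1) by algebra
  then have a': "a = (1 - t * cnj t) / ((1 - \<alpha> * cnj \<alpha>) * (1 - d) * ((1 - t) * (1 - cnj t)))"
    using ne by (simp add: eq_divide_eq mult.assoc)
  \<comment> \<open>The numerator simplifies because
    \<open>\<alpha> * \<beta> = 1 / q\<close>.\<close>
  have "t * cnj t = (\<alpha> * \<beta>) * cnj (\<alpha> * \<beta>)" by (simp add: t_def)
  then have tt: "t * cnj t = 1 / (of_nat q)\<^sup>2" unfolding prod_eq by (simp add: power2_eq_square)
  have "a = of_real ((1 - 1 / (real q)\<^sup>2) /
      ((1 - (cmod \<alpha>)\<^sup>2) * (1 - (cmod \<beta>)\<^sup>2) * (cmod (1 - t))\<^sup>2))"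
    unfolding a' tt d_def of_real_divide of_real_mult of_real_diff complex_norm_square by simp
  then show ?thesis using suma unfolding t_def complex_norm_square[symmetric]
    by (simp only: sums_of_real_iff)
qed

lemma \<Phi>_tendsto_0: "\<Phi> \<longlonglongrightarrow> 0"
proof -
  have "(\<lambda>n. (of_nat q * U (Suc (Suc n)) - U n / of_nat q) / (of_nat q + 1)) \<longlonglongrightarrow>
      (of_nat q * 0 - 0 / of_nat q) / (of_nat q + 1)"
    by (intro tendsto_divide tendsto_diff tendsto_mult tendsto_const LIMSEQ_Suc U_tendsto_0)
      (auto, metis of_nat_Suc of_nat_neq_0 add.commute)
  then have "(\<lambda>n. \<Phi> (n + 2)) \<longlonglongrightarrow> 0" by simp
  then show ?thesis by (rule LIMSEQ_offset)
qed

text \<open>Moving the root away by \<open>n\<close> steps lengthens all words by \<open>n\<close>,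
  so the boundary term disappears in the limit.\<close>

lemma boundary_tendsto_0: "(\<lambda>n. boundary (n + l) (n + m)) \<longlonglongrightarrow> 0"
proof -
  have l: "filterlim (\<lambda>n. n + c) at_top sequentially" for c :: nat
    by (rule filterlim_add_const_nat_at_top)
  have "filterlim (\<lambda>n. (n + l) + (n + m)) at_top sequentially"
    by (rule filterlim_at_top_mono[OF l[of 0]]) auto
  then have "(\<lambda>n. \<Phi> (n + l + (n + m))) \<longlonglongrightarrow> 0"
    using filterlim_compose[OF \<Phi>_tendsto_0] by blast
  moreover have "(\<lambda>n. U (n + c)) \<longlonglongrightarrow> 0" for c
    using filterlim_compose[OF U_tendsto_0 l] .
  ultimately have "(\<lambda>n. \<Phi> (Suc n + l + (Suc n + m)) + C / of_nat q * (U (n + l) * U (n + m))) \<longlonglongrightarrow>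
      0 + C / of_nat q * (0 * 0)"
    by (intro tendsto_add tendsto_mult tendsto_const) (rule LIMSEQ_Suc)
  then have "(\<lambda>n. boundary (Suc n + l) (Suc n + m)) \<longlonglongrightarrow> 0"
    by (simp add: boundary_def del: \<Phi>.simps)
  then show ?thesis by (rule LIMSEQ_imp_Suc)
qed

end
end

lemma word_dist_append_left: "word_dist (w @ x) (w @ y) = word_dist x y"
  by (induction w) auto

text \<open>The tree is bipartite, with the parity of the length as colouring.\<close>

lemma even_word_dist: "even (word_dist x y + length x + length y)"
  by (induction x y rule: word_dist.induct) auto

locale spherical_tree = tree q E + spherical q \<alpha> \<beta> for q E \<alpha> \<beta>
begin

text \<open>With the root moved away by \<open>R\<close> steps the kernel is a Gram matrix times
  \<open>C\<close> plus a boundary term. The first part is bounded by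
  \<open>schur_factorization_bound\<close> uniformly in \<open>R\<close>, the second tends to
  zero.\<close>

lemma form_values_le_strip:
  assumes \<alpha>: "cmod \<alpha> < 1" and \<beta>: "cmod \<beta> < 1"
    and bound: "\<And>t. t \<in> form_values A \<Longrightarrow> t \<le> B" and "0 \<le> B"
    and t: "t \<in> form_values (\<lambda>x y. \<Phi> (graph_dist E x y) * A x y)"
  shows "t \<le> cmod C * ((1 - 1 / real q) * (\<Sum>n. (cmod (U n))\<^sup>2)) * B"
proof -
  from t obtain F u v where F: "finite F" and u: "(\<Sum>x\<in>F. (cmod (u x))\<^sup>2) \<le> 1"
    and v: "(\<Sum>x\<in>F. (cmod (v x))\<^sup>2) \<le> 1"
    and t: "t = cmod (\<Sum>x\<in>F. \<Sum>y\<in>F. u x * (\<Phi> (graph_dist E x y) * A x y) * v y)"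
    by (rule form_valuesE)
  obtain f where f: "\<And>x. x \<in> F \<Longrightarrow> f x \<in> lists {..<q}"
    and dist: "\<And>x y. x \<in> F \<Longrightarrow> y \<in> F \<Longrightarrow> graph_dist E x y = word_dist (f x) (f y)"
    using ex_words_of_finite[OF F] by blast
  define M where "M = (1 - 1 / real q) * (\<Sum>n. (cmod (U n))\<^sup>2)"
  \<comment> \<open>A common prefix of \<open>R\<close> letters preserves distances and moves the
    root.\<close>
  define g where "g R x = replicate R 0 @ f x" for R x
  define L where "L R = R + Max (insert 0 ((\<lambda>x. length (f x)) ` F))" for R
  have g: "g R x \<in> lists {..<q}" "length (g R x) \<le> L R" if "x \<in> F" for R x
    using f[OF that] that F q_ge_2 by (auto simp: g_def L_def)
  define S where "S R = (\<Sum>x\<in>F. \<Sum>y\<in>F. u x * (gram U U (L R) (g R x) (g R y) * A x y) * v y)" for R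
  define T where "T = (\<Sum>x\<in>F. \<Sum>y\<in>F. u x * (\<Phi> (graph_dist E x y) * A x y) * v y)"
  define D where "D R = (\<Sum>x\<in>F. \<Sum>y\<in>F. u x *
    (boundary (R + length (f x)) (R + length (f y)) * A x y) * v y)" for R
  have "T = C * S R + D R" for R
  proof -
    have "\<Phi> (graph_dist E x y) = C * gram U U (L R) (g R x) (g R y)
        + boundary (R + length (f x)) (R + length (f y))" if "x \<in> F" "y \<in> F" for x y
      using \<Phi>_word_dist[OF g(1) g(1), of x y R R "L R"] g(2)[of x R] that dist[OF that]
      by (simp add: g_def word_dist_append_left)
    then have "T = (\<Sum>x\<in>F. \<Sum>y\<in>F. u x * ((C * gram U U (L R) (g R x) (g R y)
        + boundary (R + length (f x)) (R + length (f y))) * A x y) * v y)"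
      unfolding T_def by (intro sum.cong refl) auto
    then show ?thesis
      unfolding S_def D_def sum_distrib_left sum.distrib[symmetric] by (simp add: algebra_simps)
  qed
  then have T: "T - D R = C * S R" for R by (metis add_diff_cancel_right')
  have summ: "summable (\<lambda>n. (cmod (U n))\<^sup>2)" using sums_U_sq[OF \<alpha> \<beta>] sums_summable by blast
  then have M: "0 \<le> M" using q_ge_2 unfolding M_def by (intro mult_nonneg_nonneg suminf_nonneg) auto
  have "cmod (S R) \<le> M * B" for R
  proof -
    have sq: "(\<Sum>(w, a)\<in>V (L R) \<times> {..<q}. (cmod (coef U (g R x) w a))\<^sup>2) \<le> M" if "x \<in> F" for x
    proof -
      have "(\<Sum>i<length (g R x). (cmod (U i))\<^sup>2) \<le> (\<Sum>n. (cmod (U n))\<^sup>2)"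
        by (rule sum_le_suminf[OF summ]) auto
      then show ?thesis unfolding sum.cartesian_product[symmetric] sum_norm_coef[OF g[OF that]] M_def
        using q_ge_2 by (intro mult_left_mono) auto
    qed
    have "S R = (\<Sum>x\<in>F. \<Sum>y\<in>F. u x * ((\<Sum>j\<in>V (L R) \<times> {..<q}.
        (case j of (w, a) \<Rightarrow> coef U (g R x) w a) * (case j of (w, a) \<Rightarrow> coef U (g R y) w a)) * A x y) * v y)"
      unfolding S_def gram_def sum.cartesian_product by (simp add: case_prod_unfold)
    also have "cmod \<dots> \<le> M * B"
      by (rule schur_factorization_bound[OF bound \<open>0 \<le> B\<close> M F _ _ u v])
        (use sq in \<open>auto simp: case_prod_unfold\<close>)
    finally show ?thesis .
  qed
  then have "cmod (T - D R) \<le> cmod C * (M * B)" for R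
    unfolding T norm_mult by (simp add: mult_left_mono)
  moreover have "D \<longlonglongrightarrow> (\<Sum>x\<in>F. \<Sum>y\<in>F. u x * (0 * A x y) * v y)"
    unfolding D_def by (intro tendsto_intros boundary_tendsto_0[OF \<alpha> \<beta>])
  then have "(\<lambda>R. cmod (T - D R)) \<longlonglongrightarrow> cmod (T - 0)" by (intro tendsto_intros) simp
  ultimately have "cmod T \<le> cmod C * (M * B)"
    by (intro LIMSEQ_le_const2[where X = "\<lambda>R. cmod (T - D R)"]) auto
  then show ?thesis unfolding t T_def M_def by (simp add: mult.assoc)
qed

text \<open>By parity the kernel is a product of a unimodular function of \<open>x\<close> and one
  of \<open>y\<close>, a factorization over a one-element index set.\<close>

lemma form_values_le_sign:
  assumes bound: "\<And>t. t \<in> form_values A \<Longrightarrow> t \<le> B" and "0 \<le> B"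
    and \<epsilon>: "\<epsilon>\<^sup>2 = 1" "\<And>n. \<Phi> n = \<epsilon> ^ n"
    and t: "t \<in> form_values (\<lambda>x y. \<Phi> (graph_dist E x y) * A x y)"
  shows "t \<le> B"
proof -
  from t obtain F u v where F: "finite F" and u: "(\<Sum>x\<in>F. (cmod (u x))\<^sup>2) \<le> 1"
    and v: "(\<Sum>x\<in>F. (cmod (v x))\<^sup>2) \<le> 1"
    and t: "t = cmod (\<Sum>x\<in>F. \<Sum>y\<in>F. u x * (\<Phi> (graph_dist E x y) * A x y) * v y)"
    by (rule form_valuesE)
  obtain f where dist: "\<And>x y. x \<in> F \<Longrightarrow> y \<in> F \<Longrightarrow> graph_dist E x y = word_dist (f x) (f y)"
    using ex_words_of_finite[OF F] by blast
  have "cmod \<epsilon> = 1" using \<epsilon>(1) by (metis norm_one norm_power power2_eq_1_iff norm_minus_cancel)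
  have even: "\<epsilon> ^ n = 1" if "even n" for n
    using that \<epsilon>(1) by (auto elim!: evenE simp: power_mult)
  have sgn: "\<Phi> (word_dist x y) = \<epsilon> ^ length x * \<epsilon> ^ length y" for x y
  proof -
    have "\<epsilon> ^ word_dist x y * (\<epsilon> ^ length x * \<epsilon> ^ length y) = 1"
      using even[OF even_word_dist[of x y]] by (simp add: power_add mult.assoc)
    moreover have "(\<epsilon> ^ length x * \<epsilon> ^ length y) * (\<epsilon> ^ length x * \<epsilon> ^ length y) = 1"
      using even[of "length x + length x + (length y + length y)"]
      by (simp add: power_add algebra_simps)
    ultimately show ?thesis unfolding \<epsilon>(2) by (metis mult.assoc mult.left_neutral mult.right_neutral)
  qed
  have "t = cmod (\<Sum>x\<in>F. \<Sum>y\<in>F. u x * ((\<Sum>j\<in>{()}. \<epsilon> ^ length (f x) * \<epsilon> ^ length (f y)) * A x y) * v y)"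
    unfolding t by (intro arg_cong[of _ _ cmod] sum.cong refl) (simp add: dist sgn)
  also have "\<dots> \<le> 1 * B"
    by (rule schur_factorization_bound[OF bound \<open>0 \<le> B\<close> _ F _ _ u v])
      (simp_all add: norm_power \<open>cmod \<epsilon> = 1\<close>)
  finally show ?thesis by simp
qed

end

section \<open>Lower bound\<close>

context arity
begin

section \<open>Sums over words below a prefix and a Bessel inequality\<close>

lemma sum_W_snoc: "(\<Sum>x\<in>W (Suc n). f x) = (\<Sum>v\<in>W n. \<Sum>b<q. f (v @ [b]))"
proof (induction n arbitrary: f)
  case 0 then show ?case by (simp add: sum_W_Suc)
next
  case (Suc n)
  have "(\<Sum>x\<in>W (Suc (Suc n)). f x) = (\<Sum>b<q. \<Sum>t\<in>W (Suc n). f (b # t))" by (rule sum_W_Suc)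
  also have "\<dots> = (\<Sum>b<q. \<Sum>v\<in>W n. \<Sum>c<q. f (b # v @ [c]))" by (simp only: Suc.IH)
  also have "\<dots> = (\<Sum>v\<in>W (Suc n). \<Sum>b<q. f (v @ [b]))" by (simp add: sum_W_Suc)
  finally show ?case .
qed

text \<open>At this length the words with a nonzero coordinate at \<open>v\<close> have the form
  \<open>v @ b # t\<close> with \<open>t\<close> of length \<open>i\<close>.\<close>

lemma sum_W_coef:
  "v \<in> lists {..<q} \<Longrightarrow> (\<Sum>x\<in>W (Suc (length v + i)). coef k x v a * G x) =
    k i * (\<Sum>b<q. \<Sum>t\<in>W i. centering a b * G (v @ b # t))"
proof (induction v arbitrary: G)
  case Nil
  have "(\<Sum>t\<in>W i. k (length t) * centering a b * G (b # t)) =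
      k i * (\<Sum>t\<in>W i. centering a b * G (b # t))" for b
    unfolding sum_distrib_left by (rule sum.cong) (auto simp: W_def)
  then show ?case by (simp add: sum_W_Suc sum_distrib_left)
next
  case (Cons c v)
  have "(\<Sum>x\<in>W (Suc (length (c # v) + i)). coef k x (c # v) a * G x) =
      (\<Sum>b<q. if b = c then (\<Sum>t\<in>W (Suc (length v + i)). coef k t v a * G (c # t)) else 0)"
    unfolding sum_W_Suc[of _ "length (c # v) + i"] by (intro sum.cong refl) simp
  also have "\<dots> = k i * (\<Sum>b<q. \<Sum>t\<in>W i. centering a b * G ((c # v) @ b # t))"
    using Cons by simp
  finally show ?case .
qed

lemma sum_lessThan_Suc_shift_zero:
  fixes h :: "nat \<Rightarrow> complex"
  assumes "\<And>l. l \<le> p \<Longrightarrow> h l = 0"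
  shows "(\<Sum>l<Suc L. h l) = (\<Sum>i<L - p. h (Suc (p + i)))"
proof (cases "L \<le> p")
  case False
  then obtain d where "L = p + d" using le_Suc_ex nat_le_linear by blast
  moreover have "(\<Sum>l<Suc (p + d). h l) = (\<Sum>i<d. h (Suc (p + i)))"
    by (induction d) (use assms in \<open>auto intro: sum.neutral\<close>)
  ultimately show ?thesis by simp
qed (use assms in \<open>auto intro!: sum.neutral\<close>)

lemma sum_V_coef:
  assumes "v \<in> lists {..<q}"
  shows "(\<Sum>x\<in>V (Suc L). coef k x v a * G x) =
    (\<Sum>i<L - length v. k i * (\<Sum>b<q. \<Sum>t\<in>W i. centering a b * G (v @ b # t)))"
proof -
  have "(\<Sum>x\<in>W l. coef k x v a * G x) = 0" if "l \<le> length v" for l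
    using that by (intro sum.neutral) (auto simp: W_def coef_eq_0)
  then have "(\<Sum>x\<in>V (Suc L). coef k x v a * G x) =
      (\<Sum>i<L - length v. \<Sum>x\<in>W (Suc (length v + i)). coef k x v a * G x)"
    unfolding sum_V by (rule sum_lessThan_Suc_shift_zero)
  then show ?thesis unfolding sum_W_coef[OF assms] .
qed

text \<open>Pythagoras: the component along the constants is removed.\<close>

lemma sum_norm_centering:
  "(\<Sum>a<q. (cmod (\<Sum>b<q. centering a b * y b))\<^sup>2) =
    (\<Sum>b<q. (cmod (y b))\<^sup>2) - (cmod (\<Sum>b<q. y b))\<^sup>2 / real q"
proof -
  define Y where "Y = (\<Sum>b<q. y b)"
  have eq: "(\<Sum>b<q. centering a b * y b) = y a - Y / of_nat q" if "a < q" for a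
  proof -
    have "(\<Sum>b<q. centering a b * y b) = (\<Sum>b<q. (if a = b then y b else 0)) - Y / of_nat q"
      unfolding Y_def sum_divide_distrib sum_subtractf[symmetric]
      by (rule sum.cong) (auto simp: centering_def algebra_simps)
    then show ?thesis using that by simp
  qed
  have "complex_of_real (\<Sum>a<q. (cmod (\<Sum>b<q. centering a b * y b))\<^sup>2) =
      (\<Sum>a<q. (y a - Y / of_nat q) * cnj (y a - Y / of_nat q))"
    unfolding of_real_sum complex_norm_square by (intro sum.cong refl) (simp add: eq)
  also have "\<dots> = (\<Sum>a<q. y a * cnj (y a) - y a * (cnj Y / of_nat q) - cnj (y a) * (Y / of_nat q)
      + Y * cnj Y / (of_nat q)\<^sup>2)"
    by (intro sum.cong refl) (simp add: algebra_simps power2_eq_square diff_divide_distrib)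
  also have "\<dots> = (\<Sum>a<q. y a * cnj (y a)) - Y * (cnj Y / of_nat q) - cnj Y * (Y / of_nat q)
      + of_nat q * (Y * cnj Y / (of_nat q)\<^sup>2)"
    unfolding sum.distrib sum_subtractf sum_distrib_right[symmetric] Y_def by (simp add: cnj_sum)
  also have "\<dots> = (\<Sum>a<q. y a * cnj (y a)) - Y * cnj Y / of_nat q"
    by (simp add: power2_eq_square field_simps)
  also have "\<dots> = complex_of_real ((\<Sum>b<q. (cmod (y b))\<^sup>2) - (cmod Y)\<^sup>2 / real q)"
    by (simp add: complex_norm_square del: of_real_power)
  finally show ?thesis unfolding Y_def of_real_eq_iff .
qed

lemma sum_triangle_Suc:
  fixes f :: "nat \<Rightarrow> nat \<Rightarrow> real"
  shows "(\<Sum>p<Suc L. \<Sum>i<Suc L - p. f p i) = (\<Sum>p<L. \<Sum>i<L - p. f p i) + (\<Sum>p<Suc L. f p (L - p))"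
proof -
  have "(\<Sum>p<Suc L. \<Sum>i<Suc L - p. f p i) = (\<Sum>p<Suc L. (\<Sum>i<L - p. f p i) + f p (L - p))"
    by (rule sum.cong) (auto simp: Suc_diff_le)
  then show ?thesis by (simp add: sum.distrib)
qed

text \<open>The differences telescope along each antidiagonal \<open>p + i + 1 = l\<close>; the
  induction adds one antidiagonal at a time.\<close>

lemma sum_triangle_telescope:
  fixes Z :: "nat \<Rightarrow> nat \<Rightarrow> real"
  shows "(\<Sum>p<L. \<Sum>i<L - p. Z (Suc p) i - Z p (Suc i)) = (\<Sum>l<L. Z (Suc l) 0 - Z 0 (Suc l))"
proof (induction L)
  case (Suc L)
  have "(\<Sum>p<Suc L. Z (Suc p) (L - p) - Z p (Suc (L - p))) =
      (\<Sum>p<Suc L. Z (Suc p) (Suc L - Suc p) - Z p (Suc L - p))"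
    by (rule sum.cong) (auto simp: Suc_diff_le)
  also have "\<dots> = Z (Suc L) 0 - Z 0 (Suc L)"
    by (subst sum_lessThan_telescope) simp
  finally show ?case using Suc by (simp only: sum_triangle_Suc sum.lessThan_Suc)
qed simp

text \<open>A Bessel inequality: the partial sums of \<open>u\<close> over descendants form a martingale,
  whose increments are orthogonal.\<close>

lemma coef_bessel:
  assumes B: "\<And>n. (\<Sum>i<n. (cmod (k i))\<^sup>2 * real q ^ i) \<le> B"
  shows "(\<Sum>v\<in>V L. \<Sum>a<q. (cmod (\<Sum>x\<in>V (Suc L). coef k x v a * u x))\<^sup>2) \<le>
    B * (\<Sum>x\<in>V (Suc L). (cmod (u x))\<^sup>2)"
proof -
  \<comment> \<open>\<open>s i v\<close> sums \<open>u\<close> over the descendants of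
    \<open>v\<close> exactly \<open>i\<close> generations below, \<open>r\<close> centres these sums
    over siblings, and \<open>Z p i\<close> is their normalized energy on level
    \<open>p\<close>.\<close>
  define s where "s i v = (\<Sum>t\<in>W i. u (v @ t))" for i v
  define r where "r i v a = (\<Sum>b<q. centering a b * s i (v @ [b]))" for i v a
  define Z where "Z p i = (\<Sum>v\<in>W p. (cmod (s i v))\<^sup>2) / real q ^ i" for p i
  have B0: "0 \<le> B" using B[of 0] by simp
  have sqrt_power: "(sqrt (real q) ^ i)\<^sup>2 = real q ^ i" for i
    by (metis mult.commute of_nat_0_le_iff power_mult real_sqrt_pow2)
  \<comment> \<open>Cauchy-Schwarz over \<open>i\<close>, with the weight \<open>q ^ i\<close> given
    to the coefficients \<open>k i\<close> and taken from the sums \<open>r i v a\<close>.\<close>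
  have cs: "(cmod (\<Sum>x\<in>V (Suc L). coef k x v a * u x))\<^sup>2 \<le>
      B * (\<Sum>i<L - p. (cmod (r i v a))\<^sup>2 / real q ^ i)" if "v \<in> W p" for v a p
  proof -
    have v: "v \<in> lists {..<q}" "length v = p" using that by (auto simp: W_def)
    define n where "n = L - p"
    define f where "f i = cmod (k i) * sqrt (real q) ^ i" for i
    define g where "g i = cmod (r i v a) / sqrt (real q) ^ i" for i
    have "(\<Sum>x\<in>V (Suc L). coef k x v a * u x) = (\<Sum>i<n. k i * r i v a)"
      unfolding sum_V_coef[OF v(1)] v(2) n_def r_def s_def
      by (simp add: sum_distrib_left)
    then have "cmod (\<Sum>x\<in>V (Suc L). coef k x v a * u x) \<le> (\<Sum>i<n. \<bar>f i\<bar> * \<bar>g i\<bar>)"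
      unfolding f_def g_def by (auto intro!: sum_norm_le simp: norm_mult)
    also have "\<dots> \<le> L2_set f {..<n} * L2_set g {..<n}" by (rule L2_set_mult_ineq)
    finally have "(cmod (\<Sum>x\<in>V (Suc L). coef k x v a * u x))\<^sup>2 \<le>
        (L2_set f {..<n} * L2_set g {..<n})\<^sup>2" by (simp add: power_mono)
    also have "\<dots> = (\<Sum>i<n. (f i)\<^sup>2) * (\<Sum>i<n. (g i)\<^sup>2)"
      by (simp add: power_mult_distrib L2_set_def sum_nonneg)
    also have "\<dots> = (\<Sum>i<n. (cmod (k i))\<^sup>2 * real q ^ i) * (\<Sum>i<n. (cmod (r i v a))\<^sup>2 / real q ^ i)"
      by (simp add: f_def g_def power_mult_distrib power_divide sqrt_power)
    also have "\<dots> \<le> B * (\<Sum>i<n. (cmod (r i v a))\<^sup>2 / real q ^ i)"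
      by (intro mult_right_mono B sum_nonneg) simp
    finally show ?thesis unfolding n_def .
  qed
  \<comment> \<open>By \<open>sum_norm_centering\<close> the centred part is the energy lost when
    the sums over the children are merged into the sum at the parent.\<close>
  have diff: "(\<Sum>v\<in>W p. \<Sum>a<q. (cmod (r i v a))\<^sup>2 / real q ^ i) = Z (Suc p) i - Z p (Suc i)" for p i
  proof -
    have "s (Suc i) v = (\<Sum>b<q. s i (v @ [b]))" for v by (simp add: s_def sum_W_Suc)
    then have "(\<Sum>a<q. (cmod (r i v a))\<^sup>2) =
        (\<Sum>b<q. (cmod (s i (v @ [b])))\<^sup>2) - (cmod (s (Suc i) v))\<^sup>2 / real q" for v
      unfolding r_def sum_norm_centering by simp
    then show ?thesis unfolding sum_divide_distrib[symmetric] Z_def sum_W_snoc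
      by (simp add: sum_subtractf sum_divide_distrib diff_divide_distrib mult.commute)
  qed
  have "(\<Sum>v\<in>V L. \<Sum>a<q. (cmod (\<Sum>x\<in>V (Suc L). coef k x v a * u x))\<^sup>2) \<le>
      (\<Sum>p<L. \<Sum>v\<in>W p. \<Sum>a<q. B * (\<Sum>i<L - p. (cmod (r i v a))\<^sup>2 / real q ^ i))"
    unfolding sum_V[of _ L] by (intro sum_mono cs)
  also have "\<dots> = B * (\<Sum>p<L. \<Sum>v\<in>W p. \<Sum>a<q. \<Sum>i<L - p. (cmod (r i v a))\<^sup>2 / real q ^ i)"
    by (simp add: sum_distrib_left)
  also have "(\<Sum>p<L. \<Sum>v\<in>W p. \<Sum>a<q. \<Sum>i<L - p. (cmod (r i v a))\<^sup>2 / real q ^ i) =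
      (\<Sum>p<L. \<Sum>i<L - p. \<Sum>v\<in>W p. \<Sum>a<q. (cmod (r i v a))\<^sup>2 / real q ^ i)"
  proof (intro sum.cong refl)
    fix p
    have "(\<Sum>v\<in>W p. \<Sum>a<q. \<Sum>i<L - p. (cmod (r i v a))\<^sup>2 / real q ^ i) =
        (\<Sum>v\<in>W p. \<Sum>i<L - p. \<Sum>a<q. (cmod (r i v a))\<^sup>2 / real q ^ i)"
      by (intro sum.cong refl sum.swap)
    also have "\<dots> = (\<Sum>i<L - p. \<Sum>v\<in>W p. \<Sum>a<q. (cmod (r i v a))\<^sup>2 / real q ^ i)"
      by (rule sum.swap)
    finally show "(\<Sum>v\<in>W p. \<Sum>a<q. \<Sum>i<L - p. (cmod (r i v a))\<^sup>2 / real q ^ i) =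
        (\<Sum>i<L - p. \<Sum>v\<in>W p. \<Sum>a<q. (cmod (r i v a))\<^sup>2 / real q ^ i)" .
  qed
  also have "\<dots> = (\<Sum>l<L. Z (Suc l) 0 - Z 0 (Suc l))"
    unfolding diff by (rule sum_triangle_telescope)
  also have "B * \<dots> \<le> B * (\<Sum>l<Suc L. Z l 0)"
  proof (rule mult_left_mono[OF _ B0])
    \<comment> \<open>After telescoping the terms \<open>Z l 0\<close> are the squared norms of
      \<open>u\<close> on the levels; the subtracted terms are dropped.\<close>
    have Z: "0 \<le> Z p i" for p i by (simp add: Z_def sum_nonneg)
    have "(\<Sum>l<L. Z (Suc l) 0 - Z 0 (Suc l)) \<le> (\<Sum>l<L. Z (Suc l) 0)"
      by (rule sum_mono) (simp add: Z)
    also have "\<dots> \<le> (\<Sum>l<Suc L. Z l 0)" unfolding sum.lessThan_Suc_shift by (simp add: Z)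
    finally show "(\<Sum>l<L. Z (Suc l) 0 - Z 0 (Suc l)) \<le> (\<Sum>l<Suc L. Z l 0)" .
  qed
  also have "(\<Sum>l<Suc L. Z l 0) = (\<Sum>x\<in>V (Suc L). (cmod (u x))\<^sup>2)"
    unfolding sum_V by (simp add: Z_def s_def)
  finally show ?thesis .
qed

section \<open>The test matrix and its norm\<close>

lemma gram_eq:
  assumes "length x \<le> L"
  shows "gram k k' L x y = gram k k' (length x) x y"
  unfolding gram_def
proof (rule sum.mono_neutral_right)
  show "\<forall>v\<in>V L - V (length x). (\<Sum>a<q. coef k x v a * coef k' y v a) = 0"
  proof (intro ballI sum.neutral)
    fix v a assume "v \<in> V L - V (length x)"
    then have "length x \<le> length v" by (auto simp: V_def)
    then show "coef k x v a * coef k' y v a = 0" by (simp add: coef_eq_0)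
  qed
qed (use assms in \<open>auto simp: V_def\<close>, simp flip: V_def)

text \<open>The cutoff \<open>length x\<close> is exact by \<open>gram_eq\<close>, so one infinite
  matrix serves all truncations.\<close>

definition word_matrix :: "(nat \<Rightarrow> complex) \<Rightarrow> nat list \<Rightarrow> nat list \<Rightarrow> complex" where
  "word_matrix k x y = gram k k (length x) x y"

text \<open>The matrix is the product of the transposed coefficient map and the map itself, and
  \<open>coef_bessel\<close> bounds the squared norm of that map by \<open>B\<close>.\<close>

lemma word_matrix_bound:
  assumes B: "\<And>n. (\<Sum>i<n. (cmod (k i))\<^sup>2 * real q ^ i) \<le> B"
    and S: "finite S" "S \<subseteq> lists {..<q}"
    and u: "(\<Sum>x\<in>S. (cmod (u x))\<^sup>2) \<le> 1" and v: "(\<Sum>x\<in>S. (cmod (v x))\<^sup>2) \<le> 1"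
  shows "cmod (\<Sum>x\<in>S. \<Sum>y\<in>S. u x * word_matrix k x y * v y) \<le> B"
proof -
  define L where "L = Max (insert 0 (length ` S))"
  have L: "length x \<le> L" if "x \<in> S" for x using that S by (simp add: L_def)
  then have sub: "S \<subseteq> V (Suc L)" using S by (fastforce simp: V_def less_Suc_eq_le)
  define J where "J = V L \<times> {..<q}"
  define T where "T w j = (\<Sum>x\<in>S. coef k x (fst j) (snd j) * w x)" for w j
  have B0: "0 \<le> B" using B[of 0] by simp
  have T: "L2_set (\<lambda>j. cmod (T w j)) J \<le> sqrt B" if w: "(\<Sum>x\<in>S. (cmod (w x))\<^sup>2) \<le> 1" for w
  proof -
    \<comment> \<open>Extension by zero from \<open>S\<close> to a ball, where the Bessel inequality
      is available.\<close>
    define w' where "w' x = (if x \<in> S then w x else 0)" for x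
    have "T w j = (\<Sum>x\<in>V (Suc L). coef k x (fst j) (snd j) * w' x)" for j
      unfolding T_def w'_def by (rule sum.mono_neutral_cong_left) (use sub in auto)
    then have "(\<Sum>j\<in>J. (cmod (T w j))\<^sup>2) =
        (\<Sum>v\<in>V L. \<Sum>a<q. (cmod (\<Sum>x\<in>V (Suc L). coef k x v a * w' x))\<^sup>2)"
      unfolding J_def sum.cartesian_product by (simp add: case_prod_unfold)
    also have "\<dots> \<le> B * (\<Sum>x\<in>V (Suc L). (cmod (w' x))\<^sup>2)" by (rule coef_bessel[OF B])
    also have "(\<Sum>x\<in>V (Suc L). (cmod (w' x))\<^sup>2) = (\<Sum>x\<in>S. (cmod (w x))\<^sup>2)"
      unfolding w'_def by (rule sum.mono_neutral_cong_right) (use sub in auto)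
    also have "B * \<dots> \<le> B * 1" by (intro mult_left_mono w B0)
    finally show ?thesis by (simp add: L2_set_def)
  qed
  have "(\<Sum>x\<in>S. \<Sum>y\<in>S. u x * word_matrix k x y * v y) =
      (\<Sum>x\<in>S. \<Sum>y\<in>S. \<Sum>j\<in>J. (coef k x (fst j) (snd j) * u x) * (coef k y (fst j) (snd j) * v y))"
  proof (intro sum.cong refl)
    fix x y assume "x \<in> S" "y \<in> S"
    then have "word_matrix k x y = gram k k L x y" unfolding word_matrix_def using gram_eq L by metis
    then show "u x * word_matrix k x y * v y =
        (\<Sum>j\<in>J. (coef k x (fst j) (snd j) * u x) * (coef k y (fst j) (snd j) * v y))"
      by (simp add: gram_def J_def sum.cartesian_product case_prod_unfold sum_distrib_left
          sum_distrib_right mult_ac)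
  qed
  also have "\<dots> = (\<Sum>x\<in>S. \<Sum>j\<in>J. \<Sum>y\<in>S. (coef k x (fst j) (snd j) * u x) * (coef k y (fst j) (snd j) * v y))"
    by (intro sum.cong refl sum.swap)
  also have "\<dots> = (\<Sum>j\<in>J. T u j * T v j)"
    unfolding T_def sum_product by (rule sum.swap)
  also have "cmod \<dots> \<le> (\<Sum>j\<in>J. \<bar>cmod (T u j)\<bar> * \<bar>cmod (T v j)\<bar>)"
    by (auto intro!: sum_norm_le simp: norm_mult)
  also have "\<dots> \<le> L2_set (\<lambda>j. cmod (T u j)) J * L2_set (\<lambda>j. cmod (T v j)) J"
    by (rule L2_set_mult_ineq)
  also have "\<dots> \<le> sqrt B * sqrt B" by (intro mult_mono T u v) (use B0 in auto)
  finally show ?thesis using B0 by simp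
qed

section \<open>Radial test vectors and orthogonality of the coordinates\<close>

lemma coef_append_gt:
  "length v < length v' \<Longrightarrow> length w = length w' \<Longrightarrow> coef k (v' @ w) v a = coef k (v' @ w') v a"
  by (induction k v' v a rule: coef.induct) auto

lemma coef_append_eq:
  "length v' = length v \<Longrightarrow>
    coef k (v' @ b # t) v a = (if v' = v then k (length t) * centering a b else 0)"
  by (induction v' v rule: list_induct2) auto

lemma sum_radial_centering:
  assumes "a < q" and "\<And>b t. t \<in> W i \<Longrightarrow> b < q \<Longrightarrow> G (v @ b # t) = c"
  shows "(\<Sum>b<q. \<Sum>t\<in>W i. centering a b * G (v @ b # t)) = 0"
proof -
  have "(\<Sum>b<q. \<Sum>t\<in>W i. centering a b * G (v @ b # t)) =
      (\<Sum>b<q. centering b a * (of_nat (q ^ i) * c))"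
    using assms(2) by (intro sum.cong refl) (simp add: card_W centering_commute)
  also have "\<dots> = 0"
    unfolding sum_distrib_right[symmetric] sum_centering[OF assms(1)] by simp
  finally show ?thesis .
qed

text \<open>Below a longer prefix \<open>v'\<close> the coordinate at \<open>v\<close> is constant
  on each level and is killed by centring. Distinct prefixes of equal length have disjoint supports,
  and equal ones give the projection by idempotence.\<close>

lemma sum_V_coef_coef_aux:
  assumes v: "v \<in> V L" "v' \<in> V L" "a < q" "a' < q" "length v \<le> length v'"
  shows "(\<Sum>x\<in>V (Suc L). coef k' x v' a' * (coef k x v a * h (length x))) =
    (if v = v' then centering a a' *
      (\<Sum>i<L - length v. k i * k' i * h (Suc (length v + i)) * of_nat (q ^ i)) else 0)"
proof -
  have v': "v' \<in> lists {..<q}" using v by (simp add: V_def)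
  have G: "(\<Sum>b<q. \<Sum>t\<in>W i. centering a' b * (coef k (v' @ b # t) v a * h (length (v' @ b # t)))) =
      (if v = v' then centering a a' * k i * h (Suc (length v + i)) * of_nat (q ^ i) else 0)" for i
  proof (cases "length v = length v' \<and> v = v'")
    case True
    have "(\<Sum>b<q. \<Sum>t\<in>W i. centering a' b * (coef k (v' @ b # t) v a * h (length (v' @ b # t)))) =
        (\<Sum>b<q. \<Sum>t\<in>W i. (centering b a' * centering b a) * (k i * h (Suc (length v + i))))"
      using True by (intro sum.cong refl) (auto simp: coef_append_eq W_def centering_commute)
    also have "\<dots> = (\<Sum>b<q. (centering b a' * centering b a) * (k i * h (Suc (length v + i)) * of_nat (q ^ i)))"
      by (intro sum.cong refl) (simp add: card_W)
    also have "\<dots> = centering a' a * (k i * h (Suc (length v + i)) * of_nat (q ^ i))"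
      unfolding sum_distrib_right[symmetric] using v by (simp add: sum_centering_mult)
    finally show ?thesis using True by (simp add: centering_commute mult.assoc)
  next
    case False
    have "(\<Sum>b<q. \<Sum>t\<in>W i. centering a' b * (coef k (v' @ b # t) v a * h (length (v' @ b # t)))) = 0"
    proof (rule sum_radial_centering[OF v(4)])
      fix b t assume "t \<in> W i" "b < q"
      then have t: "length t = i" by (simp add: W_def)
      \<comment> \<open>The word \<open>replicate (Suc i) 0\<close> represents all continuations of
        this length, since the coordinate at the shorter \<open>v\<close> does not see their
        letters.\<close>
      show "coef k (v' @ b # t) v a * h (length (v' @ b # t)) =
          (if length v < length v' then coef k (v' @ replicate (Suc i) 0) v a else 0)
            * h (Suc (length v' + i))"
      proof (cases "length v < length v'")
        case True
        then have "coef k (v' @ b # t) v a = coef k (v' @ replicate (Suc i) 0) v a"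
          using t by (intro coef_append_gt) auto
        then show ?thesis using True t by simp
      next
        case 2: False
        then show ?thesis using False v(5) by (auto simp: coef_append_eq)
      qed
    qed
    then show ?thesis using False by auto
  qed
  show ?thesis unfolding sum_V_coef[OF v'] G
    by (auto simp: sum_distrib_left mult_ac)
qed

lemma sum_V_coef_coef:
  assumes v: "v \<in> V L" "v' \<in> V L" "a < q" "a' < q"
  shows "(\<Sum>x\<in>V (Suc L). h (length x) * coef k x v a * coef k' x v' a') =
    (if v = v' then centering a a' *
      (\<Sum>i<L - length v. k i * k' i * h (Suc (length v + i)) * of_nat (q ^ i)) else 0)"
proof (cases "length v \<le> length v'")
  case True
  then show ?thesis using sum_V_coef_coef_aux[OF v True, of k' k h] by (simp add: mult_ac)
next
  case False
  then have "length v' \<le> length v" by simp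
  from sum_V_coef_coef_aux[OF v(2,1,4,3) this, of k k' h] show ?thesis
    by (auto simp: mult_ac centering_commute)
qed

text \<open>Expanding both Gram sums gives a sum of squares over pairs of coordinates, and
  orthogonality leaves equal prefixes. The factor \<open>q - 1\<close> is the trace of the
  projection, and \<open>q ^ p\<close> counts the prefixes of length \<open>p\<close>.\<close>

lemma sum_gram_gram:
  "(\<Sum>x\<in>V (Suc L). \<Sum>y\<in>V (Suc L).
      h (length x) * (gram k k L x y * gram k' k' L x y) * h (length y)) =
    of_nat (q - 1) * (\<Sum>p<L. of_nat (q ^ p) *
      (\<Sum>i<L - p. k i * k' i * h (Suc (p + i)) * of_nat (q ^ i))\<^sup>2)"
proof -
  define R where "R v a v' a' = (\<Sum>x\<in>V (Suc L). h (length x) * coef k x v a * coef k' x v' a')"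
    for v a v' a'
  define g where "g p = (\<Sum>i<L - p. k i * k' i * h (Suc (p + i)) * of_nat (q ^ i))" for p
  define J where "J = V L \<times> {..<q}"
  define X where "X = V (Suc L)"
  have gram_J: "gram k k L x y = (\<Sum>j\<in>J. coef k x (fst j) (snd j) * coef k y (fst j) (snd j))" for k x y
    by (simp add: gram_def J_def sum.cartesian_product case_prod_unfold)
  have gram_gram: "gram k k L x y * gram k' k' L x y = (\<Sum>j\<in>J \<times> J.
      (coef k x (fst (fst j)) (snd (fst j)) * coef k y (fst (fst j)) (snd (fst j))) *
      (coef k' x (fst (snd j)) (snd (snd j)) * coef k' y (fst (snd j)) (snd (snd j))))" for x y
    unfolding gram_J sum_product sum.cartesian_product case_prod_unfold ..
  have "(\<Sum>x\<in>X. \<Sum>y\<in>X. h (length x) * (gram k k L x y * gram k' k' L x y) * h (length y)) =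
      (\<Sum>x\<in>X. \<Sum>y\<in>X. \<Sum>j\<in>J \<times> J.
        (h (length x) * coef k x (fst (fst j)) (snd (fst j)) * coef k' x (fst (snd j)) (snd (snd j))) *
        (h (length y) * coef k y (fst (fst j)) (snd (fst j)) * coef k' y (fst (snd j)) (snd (snd j))))"
    unfolding gram_gram sum_distrib_left sum_distrib_right by (intro sum.cong refl) (simp add: mult_ac)
  also have "\<dots> = (\<Sum>x\<in>X. \<Sum>j\<in>J \<times> J. \<Sum>y\<in>X.
        (h (length x) * coef k x (fst (fst j)) (snd (fst j)) * coef k' x (fst (snd j)) (snd (snd j))) *
        (h (length y) * coef k y (fst (fst j)) (snd (fst j)) * coef k' y (fst (snd j)) (snd (snd j))))"
    by (intro sum.cong refl sum.swap)
  also have "\<dots> = (\<Sum>j\<in>J \<times> J. (R (fst (fst j)) (snd (fst j)) (fst (snd j)) (snd (snd j)))\<^sup>2)"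
    unfolding R_def X_def power2_eq_square sum_product by (rule sum.swap)
  also have "\<dots> = (\<Sum>v\<in>V L. \<Sum>a<q. \<Sum>v'\<in>V L. \<Sum>a'<q. (R v a v' a')\<^sup>2)"
    unfolding J_def sum.cartesian_product by (simp add: case_prod_unfold sum.cartesian_product')
  also have "\<dots> = (\<Sum>v\<in>V L. \<Sum>a<q. \<Sum>v'\<in>V L. if v' = v then
      (\<Sum>a'<q. (centering a' a * centering a' a) * (g (length v))\<^sup>2) else 0)"
  proof (intro sum.cong refl)
    fix v a v' assume "v \<in> V L" "a \<in> {..<q}" "v' \<in> V L"
    then have "R v a v' a' = (if v = v' then centering a a' * g (length v) else 0)" if "a' < q" for a'
      unfolding R_def g_def using that by (intro sum_V_coef_coef) auto
    then show "(\<Sum>a'<q. (R v a v' a')\<^sup>2) = (if v' = v then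
      (\<Sum>a'<q. (centering a' a * centering a' a) * (g (length v))\<^sup>2) else 0)"
      by (auto intro!: sum.cong simp: power_mult_distrib power2_eq_square centering_commute)
  qed
  also have "\<dots> = (\<Sum>v\<in>V L. \<Sum>a<q. centering a a * (g (length v))\<^sup>2)"
    by (intro sum.cong refl) (simp add: sum_centering_mult flip: sum_distrib_right)
  also have "\<dots> = (\<Sum>v\<in>V L. of_nat (q - 1) * (g (length v))\<^sup>2)"
    using q_ge_2 by (intro sum.cong refl) (simp add: centering_def of_nat_diff algebra_simps)
  also have "\<dots> = (\<Sum>p<L. \<Sum>v\<in>W p. of_nat (q - 1) * (g p)\<^sup>2)"
    unfolding sum_V by (intro sum.cong refl) (auto simp: W_def)
  also have "\<dots> = of_nat (q - 1) * (\<Sum>p<L. of_nat (q ^ p) * (g p)\<^sup>2)"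
    by (simp add: card_W sum_distrib_left mult_ac)
  finally show ?thesis unfolding g_def X_def .
qed

text \<open>Every coordinate has vanishing sum over each sphere, so weights that depend on the
  lengths only see nothing of the Gram matrix.\<close>

lemma sum_radial_gram:
  "(\<Sum>x\<in>V (Suc L). \<Sum>y\<in>V (Suc L). h (length x) (length y) * gram k k L x y) = 0"
proof -
  have zero: "(\<Sum>x\<in>V (Suc L). coef k x v a * h (length x) l) = 0" if "v \<in> V L" "a < q" for v a l
  proof -
    have "v \<in> lists {..<q}" using that by (simp add: V_def)
    moreover have "(\<Sum>b<q. \<Sum>t\<in>W i. centering a b * h (length (v @ b # t)) l) = 0" for i
      using sum_radial_centering[OF \<open>a < q\<close>, of i "\<lambda>w. h (length w) l" v "h (Suc (length v + i)) l"]
      by (simp add: W_def)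
    ultimately show ?thesis by (simp only: sum_V_coef mult_zero_right sum.neutral_const)
  qed
  have "(\<Sum>x\<in>V (Suc L). \<Sum>y\<in>V (Suc L). h (length x) (length y) * gram k k L x y) =
      (\<Sum>y\<in>V (Suc L). \<Sum>x\<in>V (Suc L). h (length x) (length y) * gram k k L x y)"
    by (rule sum.swap)
  also have "\<dots> = (\<Sum>y\<in>V (Suc L). \<Sum>x\<in>V (Suc L). \<Sum>j\<in>V L \<times> {..<q}.
      coef k y (fst j) (snd j) * (coef k x (fst j) (snd j) * h (length x) (length y)))"
    by (intro sum.cong refl)
      (simp add: gram_def sum.cartesian_product case_prod_unfold sum_distrib_left mult_ac)
  also have "\<dots> = (\<Sum>y\<in>V (Suc L). \<Sum>j\<in>V L \<times> {..<q}. \<Sum>x\<in>V (Suc L).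
      coef k y (fst j) (snd j) * (coef k x (fst j) (snd j) * h (length x) (length y)))"
    by (intro sum.cong refl sum.swap)
  also have "\<dots> = 0"
    unfolding sum_distrib_left[symmetric] by (intro sum.neutral ballI) (auto simp: zero)
  finally show ?thesis .
qed

end

context spherical
begin

text \<open>The test vector \<open>u x = h (length x)\<close> annihilates the boundary term of \<open>\<Phi>_word_dist\<close>,
  because the row sums of the centering matrix vanish.\<close>

lemma sum_\<Phi>_word_matrix:
  "(\<Sum>x\<in>V (Suc L). \<Sum>y\<in>V (Suc L).
      h (length x) * (\<Phi> (word_dist x y) * word_matrix k x y) * h (length y)) =
    C * of_nat (q - 1) * (\<Sum>p<L. of_nat (q ^ p) *
      (\<Sum>i<L - p. U i * k i * h (Suc (p + i)) * of_nat (q ^ i))\<^sup>2)"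
proof -
  have "(\<Sum>x\<in>V (Suc L). \<Sum>y\<in>V (Suc L).
      h (length x) * (\<Phi> (word_dist x y) * word_matrix k x y) * h (length y)) =
    (\<Sum>x\<in>V (Suc L). \<Sum>y\<in>V (Suc L).
      C * (h (length x) * (gram U U L x y * gram k k L x y) * h (length y)) +
      (h (length x) * boundary (length x) (length y) * h (length y)) * gram k k L x y)"
  proof (intro sum.cong refl)
    fix x y assume xy: "x \<in> V (Suc L)" "y \<in> V (Suc L)"
    then have "\<Phi> (word_dist x y) = C * gram U U L x y + boundary (length x) (length y)"
      by (intro \<Phi>_word_dist) (auto simp: V_def)
    moreover have "word_matrix k x y = gram k k L x y"
      using gram_eq[of x L] xy by (simp add: word_matrix_def V_def)
    ultimately show "h (length x) * (\<Phi> (word_dist x y) * word_matrix k x y) * h (length y) =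
      C * (h (length x) * (gram U U L x y * gram k k L x y) * h (length y)) +
      (h (length x) * boundary (length x) (length y) * h (length y)) * gram k k L x y"
      by (simp add: algebra_simps)
  qed
  also have "\<dots> = C * (\<Sum>x\<in>V (Suc L). \<Sum>y\<in>V (Suc L).
      h (length x) * (gram U U L x y * gram k k L x y) * h (length y))"
    unfolding sum.distrib sum_distrib_left[symmetric]
    using sum_radial_gram[where h = "\<lambda>l m. h l * boundary l m * h m" and L = L and k = k] by simp
  finally show ?thesis unfolding sum_gram_gram by (simp add: mult.assoc)
qed

text \<open>\<open>k\<close> cancels the phases of \<open>U\<close>, and \<open>h\<close> spreads
  unit mass evenly over \<open>L + 1\<close> levels. The sum then becomes an average of squared
  partial sums of \<open>cmod (U i) * \<kappa> i\<close>.\<close>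

lemma cmod_sum_\<Phi>_word_matrix_ge:
  fixes \<kappa> :: "nat \<Rightarrow> real" and L :: nat
  defines "k \<equiv> \<lambda>i. of_real (\<kappa> i / sqrt (real q) ^ i) * cnj (sgn (U i))"
  defines "h \<equiv> \<lambda>l. of_real (1 / (sqrt (real q) ^ l * sqrt (real (Suc L))))"
  assumes \<kappa>: "\<And>i. 0 \<le> \<kappa> i" and "N \<le> L"
  shows "cmod (\<Sum>x\<in>V (Suc L). \<Sum>y\<in>V (Suc L).
      h (length x) * (\<Phi> (word_dist x y) * word_matrix k x y) * h (length y)) \<ge>
    cmod C * (1 - 1 / real q) * (real (L - N) / real (Suc L)) * (\<Sum>i<N. cmod (U i) * \<kappa> i)\<^sup>2"
proof -
  define s where "s n = (\<Sum>i<n. cmod (U i) * \<kappa> i)" for n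
  have mono: "s m \<le> s n" if "m \<le> n" for m n
    unfolding s_def using that by (intro sum_mono2) (auto simp: \<kappa>)
  have sq: "sqrt (real q) ^ i * sqrt (real q) ^ i = real q ^ i" for i
    by (simp flip: power_mult_distrib)
  have "U i * k i * h (Suc (p + i)) * of_nat (q ^ i) =
      of_real (cmod (U i) * \<kappa> i * (1 / (sqrt (real q) ^ Suc p * sqrt (real (Suc L)))))" for i p
  proof -
    have 1: "U i * k i * h (Suc (p + i)) * of_nat (q ^ i) = (U i * cnj (sgn (U i))) *
        of_real (\<kappa> i / sqrt (real q) ^ i * (1 / (sqrt (real q) ^ Suc (p + i) * sqrt (real (Suc L)))) * real q ^ i)"
      unfolding k_def h_def by (simp only: of_real_mult of_real_power of_real_of_nat_eq of_nat_power mult_ac)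
    have 2: "U i * cnj (sgn (U i)) = of_real (cmod (U i))"
      by (cases "U i = 0") (simp_all add: sgn_eq complex_norm_square[symmetric] power2_eq_square)
    \<comment> \<open>The powers of \<open>sqrt q\<close> from \<open>k\<close>, \<open>h\<close>
      and the number of words combine to one that is independent of \<open>i\<close>.\<close>
    have 3: "\<kappa> i / sqrt (real q) ^ i * (1 / (sqrt (real q) ^ Suc (p + i) * sqrt (real (Suc L)))) * real q ^ i
        = \<kappa> i * (1 / (sqrt (real q) ^ Suc p * sqrt (real (Suc L))))"
      unfolding sq[symmetric] by (simp add: power_add field_simps)
    show ?thesis unfolding 1 2 3 by (simp only: of_real_mult mult.assoc)
  qed
  then have inner: "(\<Sum>i<n. U i * k i * h (Suc (p + i)) * of_nat (q ^ i)) =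
      of_real (s n * (1 / (sqrt (real q) ^ Suc p * sqrt (real (Suc L)))))" for n p
    unfolding s_def by (simp only: of_real_sum[symmetric] sum_distrib_right)
  have cast: "of_nat (q ^ p) * (complex_of_real x)\<^sup>2 = of_real (real q ^ p * x\<^sup>2)" for p x
    by simp
  have "real q ^ p * (s n * (1 / (sqrt (real q) ^ Suc p * sqrt (real (Suc L)))))\<^sup>2 =
      (s n)\<^sup>2 / (real q * real (Suc L))" for n p
    unfolding power_mult_distrib power_divide power2_eq_square[of "sqrt (real q) ^ Suc p"] sq by simp
  then have "of_nat (q ^ p) * (\<Sum>i<n. U i * k i * h (Suc (p + i)) * of_nat (q ^ i))\<^sup>2 =
      complex_of_real ((s n)\<^sup>2 / (real q * real (Suc L)))" for n p
    unfolding inner cast by (simp only:)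
  then have "(\<Sum>x\<in>V (Suc L). \<Sum>y\<in>V (Suc L).
      h (length x) * (\<Phi> (word_dist x y) * word_matrix k x y) * h (length y)) =
    C * of_real (real (q - 1) * (\<Sum>p<L. (s (L - p))\<^sup>2 / (real q * real (Suc L))))"
    unfolding sum_\<Phi>_word_matrix by simp
  also have "cmod \<dots> = cmod C * (real (q - 1) * (\<Sum>p<L. (s (L - p))\<^sup>2 / (real q * real (Suc L))))"
    unfolding norm_mult norm_of_real by (subst abs_of_nonneg) (auto intro!: mult_nonneg_nonneg sum_nonneg)
  \<comment> \<open>For \<open>p < L - N\<close> the inner sum contains the first \<open>N\<close>
    terms; the remaining \<open>p\<close> contribute nonnegative amounts.\<close>
  also have "\<dots> \<ge> cmod C * (real (q - 1) * (\<Sum>p<L - N. (s N)\<^sup>2 / (real q * real (Suc L))))"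
  proof (intro mult_left_mono)
    have "(\<Sum>p<L - N. (s N)\<^sup>2 / (real q * real (Suc L))) \<le>
        (\<Sum>p<L - N. (s (L - p))\<^sup>2 / (real q * real (Suc L)))"
      by (intro sum_mono divide_right_mono power_mono mono) (auto simp: s_def \<kappa> intro!: sum_nonneg)
    also have "\<dots> \<le> (\<Sum>p<L. (s (L - p))\<^sup>2 / (real q * real (Suc L)))"
      by (intro sum_mono2) auto
    finally show "(\<Sum>p<L - N. (s N)\<^sup>2 / (real q * real (Suc L))) \<le>
        (\<Sum>p<L. (s (L - p))\<^sup>2 / (real q * real (Suc L)))" .
  qed auto
  also have "cmod C * (real (q - 1) * (\<Sum>p<L - N. (s N)\<^sup>2 / (real q * real (Suc L)))) =
      cmod C * (1 - 1 / real q) * (real (L - N) / real (Suc L)) * (s N)\<^sup>2"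
    using q_ge_2 by (simp add: of_nat_diff field_simps)
  finally show ?thesis unfolding s_def .
qed

end

context spherical_tree
begin

text \<open>\<open>word_matrix\<close> is carried to the tree along an isometric embedding and
  extended by zero. The same matrix serves all \<open>N\<close> and \<open>L\<close>, as a failure
  of boundedness requires.\<close>

lemma ex_bounded_matrix_large_form:
  fixes \<kappa> :: "nat \<Rightarrow> real"
  assumes \<kappa>: "\<And>i. 0 \<le> \<kappa> i" and B: "\<And>n. (\<Sum>i<n. (\<kappa> i)\<^sup>2) \<le> B"
  shows "\<exists>A. (\<forall>t\<in>form_values A. t \<le> B) \<and>
    (\<forall>N L. N \<le> L \<longrightarrow> (\<exists>t\<in>form_values (\<lambda>x y. \<Phi> (graph_dist E x y) * A x y).
      cmod C * (1 - 1 / real q) * (real (L - N) / real (Suc L)) * (\<Sum>i<N. cmod (U i) * \<kappa> i)\<^sup>2 \<le> t))"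
proof -
  obtain f where inj: "inj_on f (lists {..<q})"
    and dist: "\<And>x y. x \<in> lists {..<q} \<Longrightarrow> y \<in> lists {..<q} \<Longrightarrow> graph_dist E (f x) (f y) = word_dist x y"
    using ex_isometric_words by blast
  define k where "k = (\<lambda>i. of_real (\<kappa> i / sqrt (real q) ^ i) * cnj (sgn (U i)))"
  define g where "g = the_inv_into (lists {..<q}) f"
  have g: "g (f x) = x" if "x \<in> lists {..<q}" for x
    unfolding g_def using the_inv_into_f_f[OF inj that] .
  define A where "A a b = (if a \<in> f ` lists {..<q} \<and> b \<in> f ` lists {..<q}
    then word_matrix k (g a) (g b) else 0)" for a b
  have A_f: "A (f x) (f y) = word_matrix k x y" if "x \<in> lists {..<q}" "y \<in> lists {..<q}" for x y
    using that by (simp only: A_def g imageI) simp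
  have kB: "(\<Sum>i<n. (cmod (k i))\<^sup>2 * real q ^ i) \<le> B" for n
  proof -
    have "(cmod (k i))\<^sup>2 * real q ^ i \<le> (\<kappa> i)\<^sup>2" for i
    proof -
      have "(cmod (k i))\<^sup>2 * real q ^ i = (\<kappa> i)\<^sup>2 * (cmod (sgn (U i)))\<^sup>2"
      proof -
        have "(sqrt (real q) ^ i)\<^sup>2 = real q ^ i"
          by (metis mult.commute of_nat_0_le_iff power_mult real_sqrt_pow2)
        then show ?thesis unfolding k_def by (simp add: norm_mult norm_divide norm_power power_mult_distrib power_divide)
      qed
      also have "\<dots> \<le> (\<kappa> i)\<^sup>2 * 1" by (intro mult_left_mono) (auto simp: norm_sgn)
      finally show ?thesis by simp
    qed
    then have "(\<Sum>i<n. (cmod (k i))\<^sup>2 * real q ^ i) \<le> (\<Sum>i<n. (\<kappa> i)\<^sup>2)"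
      by (rule sum_mono)
    then show ?thesis using B[of n] by linarith
  qed
  have "t \<le> B" if "t \<in> form_values A" for t
  proof -
    from that obtain F u v where F: "finite F" and u: "(\<Sum>x\<in>F. (cmod (u x))\<^sup>2) \<le> 1"
      and v: "(\<Sum>x\<in>F. (cmod (v x))\<^sup>2) \<le> 1"
      and t: "t = cmod (\<Sum>x\<in>F. \<Sum>y\<in>F. u x * A x y * v y)"
      by (rule form_valuesE)
    define S where "S = {x \<in> lists {..<q}. f x \<in> F}"
    have S: "S \<subseteq> lists {..<q}" "f ` S \<subseteq> F" by (auto simp: S_def)
    have injS: "inj_on f S" using inj S(1) by (rule inj_on_subset)
    have "finite S" using finite_imageD[OF finite_subset[OF S(2) F] injS] .
    have restrict: "(\<Sum>x\<in>F. w x) = (\<Sum>x\<in>S. w (f x))" if "\<And>x. x \<in> F - f ` S \<Longrightarrow> w x = 0"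
      for w :: "'a \<Rightarrow> complex"
    proof -
      have "(\<Sum>x\<in>F. w x) = (\<Sum>x\<in>f ` S. w x)"
        by (rule sum.mono_neutral_right[OF F S(2)]) (use that in blast)
      then show ?thesis by (simp add: sum.reindex[OF injS])
    qed
    have out: "A a b = 0" if "a \<in> F - f ` S \<or> b \<in> F - f ` S" for a b
      using that by (auto simp: A_def S_def)
    have "(\<Sum>x\<in>F. \<Sum>y\<in>F. u x * A x y * v y) = (\<Sum>x\<in>S. \<Sum>y\<in>S. u (f x) * A (f x) (f y) * v (f y))"
      by (subst restrict, simp add: out) (intro sum.cong refl restrict, simp add: out)
    also have "\<dots> = (\<Sum>x\<in>S. \<Sum>y\<in>S. u (f x) * word_matrix k x y * v (f y))"
      by (intro sum.cong refl) (metis A_f S(1) subsetD)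
    finally have "t = cmod (\<Sum>x\<in>S. \<Sum>y\<in>S. u (f x) * word_matrix k x y * v (f y))" using t by simp
    moreover have "(\<Sum>x\<in>S. (cmod (w (f x)))\<^sup>2) \<le> (\<Sum>x\<in>F. (cmod (w x))\<^sup>2)" for w :: "'a \<Rightarrow> complex"
      using sum_mono2[OF F S(2), of "\<lambda>x. (cmod (w x))\<^sup>2"] by (simp add: sum.reindex[OF injS])
    ultimately show ?thesis
      using word_matrix_bound[OF kB \<open>finite S\<close> S(1), of "\<lambda>x. u (f x)" "\<lambda>x. v (f x)"] u v
      by (metis (no_types, lifting) order.trans)
  qed
  moreover have "\<exists>t\<in>form_values (\<lambda>x y. \<Phi> (graph_dist E x y) * A x y).
      cmod C * (1 - 1 / real q) * (real (L - N) / real (Suc L)) * (\<Sum>i<N. cmod (U i) * \<kappa> i)\<^sup>2 \<le> t"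
    if "N \<le> L" for N L
  proof -
    define h where "h = (\<lambda>l. complex_of_real (1 / (sqrt (real q) ^ l * sqrt (real (Suc L)))))"
    have VL: "V (Suc L) \<subseteq> lists {..<q}" by (auto simp: V_def)
    have injV: "inj_on f (V (Suc L))" using inj VL by (rule inj_on_subset)
    define u where "u a = h (length (g a))" for a
    have "(\<Sum>a\<in>f ` V (Suc L). \<Sum>b\<in>f ` V (Suc L). u a * (\<Phi> (graph_dist E a b) * A a b) * u b) =
        (\<Sum>x\<in>V (Suc L). \<Sum>y\<in>V (Suc L).
          h (length x) * (\<Phi> (word_dist x y) * word_matrix k x y) * h (length y))"
      unfolding sum.reindex[OF injV] o_def
    proof (intro sum.cong refl)
      fix x y assume "x \<in> V (Suc L)" "y \<in> V (Suc L)"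
      then have "x \<in> lists {..<q}" "y \<in> lists {..<q}" using VL by auto
      then show "u (f x) * (\<Phi> (graph_dist E (f x) (f y)) * A (f x) (f y)) * u (f y) =
          h (length x) * (\<Phi> (word_dist x y) * word_matrix k x y) * h (length y)"
        by (simp only: u_def A_f g dist)
    qed
    \<comment> \<open>Level \<open>p\<close> has \<open>q ^ p\<close> words of squared weight
      \<open>1 / (q ^ p * Suc L)\<close>, so each of the \<open>Suc L\<close> levels has mass
      \<open>1 / Suc L\<close>.\<close>
    moreover have "(\<Sum>a\<in>f ` V (Suc L). (cmod (u a))\<^sup>2) \<le> 1"
    proof -
      have "(\<Sum>a\<in>f ` V (Suc L). (cmod (u a))\<^sup>2) = (\<Sum>x\<in>V (Suc L). (cmod (h (length x)))\<^sup>2)"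
        unfolding sum.reindex[OF injV] o_def u_def by (intro sum.cong refl) (metis VL g subsetD)
      also have "\<dots> = (\<Sum>p<Suc L. \<Sum>x\<in>W p. 1 / (real q ^ p * real (Suc L)))"
      proof -
        have "(sqrt (real q) ^ i)\<^sup>2 = real q ^ i" for i
          by (metis mult.commute of_nat_0_le_iff power_mult real_sqrt_pow2)
        then have "(cmod (h p))\<^sup>2 = 1 / (real q ^ p * real (Suc L))" for p
          by (simp only: h_def norm_of_real power2_abs power_divide power_mult_distrib) simp
        then show ?thesis unfolding sum_V by (intro sum.cong refl) (auto simp: W_def)
      qed
      also have "\<dots> = (\<Sum>p<Suc L. 1 / real (Suc L))"
        by (intro sum.cong refl) (simp add: card_W)
      also have "\<dots> = 1" by simp
      finally show ?thesis by simp
    qed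
    ultimately have "cmod (\<Sum>x\<in>V (Suc L). \<Sum>y\<in>V (Suc L).
        h (length x) * (\<Phi> (word_dist x y) * word_matrix k x y) * h (length y)) \<in>
        form_values (\<lambda>x y. \<Phi> (graph_dist E x y) * A x y)"
      using form_valuesI[of "f ` V (Suc L)" u u "\<lambda>x y. \<Phi> (graph_dist E x y) * A x y"]
      by (simp only: finite_imageI finite_V)
    moreover have "cmod C * (1 - 1 / real q) * (real (L - N) / real (Suc L)) * (\<Sum>i<N. cmod (U i) * \<kappa> i)\<^sup>2
        \<le> cmod (\<Sum>x\<in>V (Suc L). \<Sum>y\<in>V (Suc L).
        h (length x) * (\<Phi> (word_dist x y) * word_matrix k x y) * h (length y))"
      unfolding h_def k_def by (rule cmod_sum_\<Phi>_word_matrix_ge[OF \<kappa> that])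
    ultimately show ?thesis by blast
  qed
  ultimately show ?thesis by blast
qed

end

section \<open>Schur norms\<close>

lemma form_values_nonempty [simp]: "form_values A \<noteq> {}"
  using form_valuesI[of "{}" "\<lambda>_. 0" "\<lambda>_. 0" A] by auto

lemma bounded_matrixI: "(\<And>t. t \<in> form_values A \<Longrightarrow> t \<le> B) \<Longrightarrow> bounded_matrix A"
  unfolding bounded_matrix_def by (rule bdd_aboveI)

lemma matrix_norm_leI: "(\<And>t. t \<in> form_values A \<Longrightarrow> t \<le> B) \<Longrightarrow> matrix_norm A \<le> B"
  unfolding matrix_norm_def by (rule cSup_least) auto

lemma form_values_le_matrix_norm: "bounded_matrix A \<Longrightarrow> t \<in> form_values A \<Longrightarrow> t \<le> matrix_norm A"
  unfolding matrix_norm_def bounded_matrix_def by (rule cSup_upper)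

lemma schur_multiplierI:
  fixes \<psi> :: "'a \<Rightarrow> 'a \<Rightarrow> complex"
  assumes "\<And>A B t. (\<And>s. s \<in> form_values A \<Longrightarrow> s \<le> B) \<Longrightarrow> 0 \<le> B \<Longrightarrow>
    t \<in> form_values (\<lambda>x y. \<psi> x y * A x y) \<Longrightarrow> t \<le> M * B"
  shows "schur_multiplier \<psi>"
  unfolding schur_multiplier_def
proof (intro allI impI)
  fix A :: "'a \<Rightarrow> 'a \<Rightarrow> complex" assume A: "bounded_matrix A"
  \<comment> \<open>The maximum with zero provides the nonnegative bound that the hypothesis asks
    for.\<close>
  have "s \<le> max 0 (matrix_norm A)" if "s \<in> form_values A" for s
    using form_values_le_matrix_norm[OF A that] by simp
  then show "bounded_matrix (\<lambda>x y. \<psi> x y * A x y)"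
    by (intro bounded_matrixI[where B = "M * max 0 (matrix_norm A)"] assms[of A]) auto
qed

text \<open>Replaces the nested suprema by estimates of single form values. The value
  \<open>M\<close> is approached from below because the suprema need not be attained.\<close>

lemma schur_norm_eqI:
  assumes ub: "\<And>A t. (\<And>s. s \<in> form_values A \<Longrightarrow> s \<le> 1) \<Longrightarrow>
      t \<in> form_values (\<lambda>x y. \<psi> x y * A x y) \<Longrightarrow> t \<le> M"
    and lb: "\<And>r. r < M \<Longrightarrow> \<exists>A. (\<forall>s\<in>form_values A. s \<le> 1) \<and>
      (\<exists>t\<in>form_values (\<lambda>x y. \<psi> x y * A x y). r \<le> t)"
  shows "schur_norm \<psi> = M"
proof -
  define S where "S = {matrix_norm (\<lambda>x y. \<psi> x y * A x y) | A. bounded_matrix A \<and> matrix_norm A \<le> 1}"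
  have S_ub: "r \<le> M" if "r \<in> S" for r
  proof -
    from that obtain A where A: "r = matrix_norm (\<lambda>x y. \<psi> x y * A x y)"
      "bounded_matrix A" "matrix_norm A \<le> 1" by (auto simp: S_def)
    have "s \<le> 1" if "s \<in> form_values A" for s
      using form_values_le_matrix_norm[OF A(2) that] A(3) by simp
    then show ?thesis unfolding A(1) by (intro matrix_norm_leI ub)
  qed
  have S_lb: "\<exists>s\<in>S. r \<le> s" if r: "r < M" for r
  proof -
    obtain A t where A: "\<forall>s\<in>form_values A. s \<le> 1"
      and t: "t \<in> form_values (\<lambda>x y. \<psi> x y * A x y)" "r \<le> t" using lb[OF r] by blast
    have "bounded_matrix (\<lambda>x y. \<psi> x y * A x y)"
      by (rule bounded_matrixI[where B = M], rule ub[of A]) (use A in auto)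
    from form_values_le_matrix_norm[OF this t(1)] t(2)
    have "r \<le> matrix_norm (\<lambda>x y. \<psi> x y * A x y)" by simp
    moreover have "matrix_norm (\<lambda>x y. \<psi> x y * A x y) \<in> S"
      unfolding S_def using A bounded_matrixI[of A 1] matrix_norm_leI[of A 1] by blast
    ultimately show ?thesis by blast
  qed
  have "Sup S = M"
  proof (rule antisym)
    have "S \<noteq> {}" using S_lb[of "M - 1"] by auto
    then show "Sup S \<le> M" using S_ub by (rule cSup_least)
    show "M \<le> Sup S"
    proof (rule dense_le)
      fix r assume "r < M"
      then obtain s where "s \<in> S" "r \<le> s" using S_lb by blast
      moreover have "bdd_above S" using S_ub by (rule bdd_aboveI)
      ultimately show "r \<le> Sup S" by (meson cSup_upper order.trans)
    qed
  qed
  then show ?thesis unfolding schur_norm_def S_def .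
qed

lemma tendsto_ratio_1: "(\<lambda>L. real (L - N) / real (Suc L)) \<longlonglongrightarrow> 1"
proof -
  have "(\<lambda>n. real (Suc N) / real n) \<longlonglongrightarrow> 0" by (rule lim_const_over_n)
  then have "(\<lambda>n. 1 - real (Suc N) / real (n + Suc N)) \<longlonglongrightarrow> 1 - 0"
    by (intro tendsto_diff tendsto_const LIMSEQ_ignore_initial_segment)
  moreover have "1 - real (Suc N) / real (n + Suc N) = real (n + N - N) / real (Suc (n + N))" for n
    by (simp add: field_simps)
  ultimately have "(\<lambda>n. real (n + N - N) / real (Suc (n + N))) \<longlonglongrightarrow> 1" by simp
  then show ?thesis by (rule LIMSEQ_offset)
qed

context spherical
begin

lemma U_closed: "(\<alpha> - \<beta>) * U n = \<alpha> ^ Suc n - \<beta> ^ Suc n"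
proof (induction n)
  case (Suc n)
  have "(\<alpha> - \<beta>) * U (Suc n) = \<alpha> * ((\<alpha> - \<beta>) * U n) + (\<alpha> - \<beta>) * \<beta> ^ Suc n"
    unfolding U_Suc by (simp add: algebra_simps)
  then show ?case unfolding Suc.IH by (simp add: algebra_simps)
qed simp

lemma cmod_prod: "cmod \<alpha> * cmod \<beta> = 1 / real q"
  unfolding norm_mult[symmetric] prod_eq by (simp add: norm_divide)

text \<open>If one modulus is at least 1, the other is at most \<open>1 / q\<close>, so
  \<open>\<alpha> ^ Suc n\<close> and \<open>\<beta> ^ Suc n\<close> stay \<open>1 / 2\<close>
  apart; \<open>U_closed\<close> turns this into a bound for \<open>U\<close>.\<close>

lemma U_bounded_below:
  assumes "1 \<le> cmod \<alpha> \<or> 1 \<le> cmod \<beta>"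
  shows "\<exists>\<delta>>0. \<forall>n. \<delta> \<le> cmod (U n)"
proof -
  have q2: "1 / real q \<le> 1 / 2" using q_ge_2 by (simp add: field_simps)
  have aux: "1 / 2 \<le> cmod (x ^ Suc n - y ^ Suc n)"
    if "1 \<le> cmod x" "cmod x * cmod y = 1 / real q" for x y and n
  proof -
    have "cmod y \<le> cmod x * cmod y" using that(1) by (simp add: mult_le_cancel_right1)
    then have y: "cmod y \<le> 1 / 2" using that(2) q2 by linarith
    have "cmod (y ^ Suc n) \<le> cmod y" unfolding norm_power
      by (rule power_Suc_le_self) (use y in auto)
    moreover have "1 \<le> cmod (x ^ Suc n)" unfolding norm_power using that(1) by (rule one_le_power)
    ultimately show ?thesis using y norm_triangle_ineq2[of "x ^ Suc n" "y ^ Suc n"] by linarith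
  qed
  have half: "1 / 2 \<le> cmod (\<alpha> - \<beta>) * cmod (U n)" for n
    using assms aux[of \<alpha> \<beta> n] aux[of \<beta> \<alpha> n] cmod_prod
    unfolding norm_mult[symmetric] U_closed by (auto simp: norm_minus_commute mult.commute)
  \<comment> \<open>The case \<open>n = 0\<close> shows
    \<open>\<alpha> \<noteq> \<beta>\<close>.\<close>
  then have pos: "0 < cmod (\<alpha> - \<beta>)" using half[of 0] unfolding U_0 norm_one by linarith
  show ?thesis
    by (rule exI[of _ "1 / 2 / cmod (\<alpha> - \<beta>)"])
      (use half pos in \<open>auto simp: divide_le_eq mult_ac\<close>)
qed

lemma C_eq_0_iff: "C = 0 \<longleftrightarrow> \<alpha>\<^sup>2 = 1 \<or> \<beta>\<^sup>2 = 1"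
proof -
  have "(of_nat q + 1 :: complex) \<noteq> 0" by (metis of_nat_Suc of_nat_neq_0 add.commute)
  then show ?thesis by (auto simp: C_def)
qed

text \<open>One of \<open>\<alpha>\<close>, \<open>\<beta>\<close> is a sign, the other is that sign
  over \<open>q\<close>, and \<open>\<Phi> 1\<close> is the sign itself. By
  \<open>\<Phi>_diff\<close> the sequence has period two.\<close>

lemma \<Phi>_sign:
  assumes "C = 0"
  shows "\<exists>\<epsilon>. \<epsilon>\<^sup>2 = 1 \<and> (\<forall>n. \<Phi> n = \<epsilon> ^ n)"
proof -
  have q1: "(of_nat q + 1 :: complex) \<noteq> 0" by (metis of_nat_Suc of_nat_neq_0 add.commute)
  have aux: "of_nat q / (of_nat q + 1) * (x + y) = x" if "x\<^sup>2 = 1" "x * y = 1 / of_nat q" for x y :: complex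
  proof -
    have "of_nat q * y = of_nat q * (x * y) * x" using that(1) by (simp add: power2_eq_square algebra_simps)
    also have "\<dots> = x" by (simp add: that(2))
    finally show ?thesis using q1 by (simp add: field_simps)
  qed
  obtain \<epsilon> where \<epsilon>: "\<epsilon>\<^sup>2 = 1" "\<Phi> (Suc 0) = \<epsilon>"
    using assms aux[of \<alpha> \<beta>] aux[of \<beta> \<alpha>] prod_eq unfolding C_eq_0_iff
    by (auto simp: add.commute mult.commute)
  have "\<Phi> n = \<epsilon> ^ n" for n
  proof (induction n rule: induct_nat_012)
    case (ge2 n)
    have "\<Phi> (Suc (Suc n)) = \<Phi> n" using \<Phi>_diff[of n] assms by simp
    then show ?case using ge2(1) \<epsilon>(1) by (simp add: power2_eq_square flip: mult.assoc)
  qed (use \<epsilon> in simp_all)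
  then show ?thesis using \<epsilon>(1) by blast
qed

end

context spherical_tree
begin

text \<open>The upper bound is \<open>form_values_le_strip\<close>. For the lower bound
  \<open>L\<close> and \<open>N\<close> are taken large in
  \<open>ex_bounded_matrix_large_form\<close> with the optimal weights.\<close>

lemma schur_strip:
  assumes \<alpha>: "cmod \<alpha> < 1" and \<beta>: "cmod \<beta> < 1"
  shows "schur_multiplier (\<lambda>x y. \<Phi> (graph_dist E x y))"
    and "schur_norm (\<lambda>x y. \<Phi> (graph_dist E x y)) =
      cmod C * ((1 - 1 / real q) * (\<Sum>n. (cmod (U n))\<^sup>2))"
proof -
  define S where "S n = (\<Sum>i<n. (cmod (U i))\<^sup>2)" for n
  define c where "c = cmod C * (1 - 1 / real q)"
  show "schur_multiplier (\<lambda>x y. \<Phi> (graph_dist E x y))"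
    by (rule schur_multiplierI, rule form_values_le_strip[OF \<alpha> \<beta>]) auto
  show "schur_norm (\<lambda>x y. \<Phi> (graph_dist E x y)) =
      cmod C * ((1 - 1 / real q) * (\<Sum>n. (cmod (U n))\<^sup>2))"
  proof (rule schur_norm_eqI)
    fix A :: "'a \<Rightarrow> 'a \<Rightarrow> complex" and t assume A: "\<And>s. s \<in> form_values A \<Longrightarrow> s \<le> 1"
      and t: "t \<in> form_values (\<lambda>x y. \<Phi> (graph_dist E x y) * A x y)"
    show "t \<le> cmod C * ((1 - 1 / real q) * (\<Sum>n. (cmod (U n))\<^sup>2))"
      using form_values_le_strip[OF \<alpha> \<beta> A _ t] by simp
  next
    fix r assume r: "r < cmod C * ((1 - 1 / real q) * (\<Sum>n. (cmod (U n))\<^sup>2))"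
    have "S \<longlonglongrightarrow> (\<Sum>n. (cmod (U n))\<^sup>2)"
      unfolding S_def by (rule summable_LIMSEQ[OF sums_summable[OF sums_U_sq[OF \<alpha> \<beta>]]])
    then have "(\<lambda>n. c * S n) \<longlonglongrightarrow> c * (\<Sum>n. (cmod (U n))\<^sup>2)" by (intro tendsto_mult tendsto_const)
    then have evN: "eventually (\<lambda>n. r < c * S n) sequentially"
      by (rule order_tendstoD) (use r in \<open>simp add: c_def mult.assoc\<close>)
    obtain N where N: "r < c * S N" "1 \<le> N"
      using eventually_happens'[OF sequentially_bot eventually_conj[OF evN eventually_ge_at_top[of 1]]] by blast
    \<comment> \<open>\<open>N \<ge> 1\<close> and \<open>U 0 = 1\<close> allow division by
      \<open>S N\<close>.\<close>
    have "S 1 \<le> S N" unfolding S_def using N(2) by (intro sum_mono2) auto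
    then have pos: "0 < S N" by (simp add: S_def)
    have "(\<lambda>L. c * (real (L - N) / real (Suc L)) * S N) \<longlonglongrightarrow> c * 1 * S N"
      by (intro tendsto_mult tendsto_const tendsto_ratio_1)
    then have evL: "eventually (\<lambda>L. r < c * (real (L - N) / real (Suc L)) * S N) sequentially"
      by (rule order_tendstoD) (use N in simp)
    obtain L where L: "r < c * (real (L - N) / real (Suc L)) * S N" "N \<le> L"
      using eventually_happens'[OF sequentially_bot eventually_conj[OF evL eventually_ge_at_top[of N]]] by blast
    \<comment> \<open>The equality case of Cauchy-Schwarz, truncated at \<open>N\<close> and
      normalized.\<close>
    define \<kappa> where "\<kappa> i = (if i < N then cmod (U i) / sqrt (S N) else 0)" for i
    have "(\<Sum>i<n. (\<kappa> i)\<^sup>2) \<le> 1" for n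
    proof -
      have "(\<Sum>i<n. (\<kappa> i)\<^sup>2) \<le> (\<Sum>i<n + N. (\<kappa> i)\<^sup>2)" by (intro sum_mono2) auto
      also have "\<dots> = (\<Sum>i<N. (\<kappa> i)\<^sup>2)"
        by (rule sum.mono_neutral_right) (auto simp: \<kappa>_def)
      also have "\<dots> = S N / S N"
        unfolding S_def sum_divide_distrib using pos
        by (intro sum.cong refl) (simp add: \<kappa>_def power_divide flip: S_def)
      finally show ?thesis using pos by simp
    qed
    moreover have "0 \<le> \<kappa> i" for i by (simp add: \<kappa>_def S_def sum_nonneg)
    ultimately obtain A where A: "\<forall>t\<in>form_values A. t \<le> 1"
      "\<exists>t\<in>form_values (\<lambda>x y. \<Phi> (graph_dist E x y) * A x y).
        c * (real (L - N) / real (Suc L)) * (\<Sum>i<N. cmod (U i) * \<kappa> i)\<^sup>2 \<le> t"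
      using ex_bounded_matrix_large_form[of \<kappa> 1] L(2) unfolding c_def by blast
    have "(\<Sum>i<N. cmod (U i) * \<kappa> i) = (\<Sum>i<N. (cmod (U i))\<^sup>2) / sqrt (S N)"
      unfolding sum_divide_distrib by (intro sum.cong refl) (simp add: \<kappa>_def power2_eq_square)
    also have "(\<Sum>i<N. (cmod (U i))\<^sup>2) = S N" by (simp add: S_def)
    finally have "(\<Sum>i<N. cmod (U i) * \<kappa> i) = S N / sqrt (S N)" .
    then have sq: "(\<Sum>i<N. cmod (U i) * \<kappa> i)\<^sup>2 = S N"
      using pos by (simp add: real_div_sqrt)
    show "\<exists>A. (\<forall>s\<in>form_values A. s \<le> 1) \<and>
        (\<exists>t\<in>form_values (\<lambda>x y. \<Phi> (graph_dist E x y) * A x y). r \<le> t)"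
      using A(1) A(2)[unfolded sq] order.strict_implies_order[OF L(1)] by (meson order.trans)
  qed
qed

text \<open>The value 1 is attained at the matrix unit of a single vertex, because
  \<open>\<Phi> 0 = 1\<close>.\<close>

lemma schur_sign:
  assumes "C = 0"
  shows "schur_multiplier (\<lambda>x y. \<Phi> (graph_dist E x y))"
    and "schur_norm (\<lambda>x y. \<Phi> (graph_dist E x y)) = 1"
proof -
  obtain \<epsilon> where \<epsilon>: "\<epsilon>\<^sup>2 = 1" "\<And>n. \<Phi> n = \<epsilon> ^ n" using \<Phi>_sign[OF assms] by blast
  show "schur_multiplier (\<lambda>x y. \<Phi> (graph_dist E x y))"
  proof (rule schur_multiplierI)
    fix A :: "'a \<Rightarrow> 'a \<Rightarrow> complex" and B t assume "\<And>s. s \<in> form_values A \<Longrightarrow> s \<le> B" "0 \<le> B"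
      "t \<in> form_values (\<lambda>x y. \<Phi> (graph_dist E x y) * A x y)"
    then show "t \<le> 1 * B" using form_values_le_sign[of A B \<epsilon> t] \<epsilon> by simp
  qed
  show "schur_norm (\<lambda>x y. \<Phi> (graph_dist E x y)) = 1"
  proof (rule schur_norm_eqI)
    fix A :: "'a \<Rightarrow> 'a \<Rightarrow> complex" and t assume "\<And>s. s \<in> form_values A \<Longrightarrow> s \<le> 1"
      "t \<in> form_values (\<lambda>x y. \<Phi> (graph_dist E x y) * A x y)"
    then show "t \<le> 1" using form_values_le_sign[of A 1 \<epsilon> t] \<epsilon> by simp
  next
    fix r :: real assume "r < 1"
    obtain o' :: 'a where True by blast
    define A where "A x y = (if x = o' \<and> y = o' then 1 else 0 :: complex)" for x y
    have "s \<le> 1" if "s \<in> form_values A" for s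
    proof -
      from that obtain F u v where F: "finite F" and u: "(\<Sum>x\<in>F. (cmod (u x))\<^sup>2) \<le> 1"
        and v: "(\<Sum>x\<in>F. (cmod (v x))\<^sup>2) \<le> 1"
        and s: "s = cmod (\<Sum>x\<in>F. \<Sum>y\<in>F. u x * A x y * v y)"
        by (rule form_valuesE)
      have le1: "cmod (w o') \<le> 1" if "(\<Sum>x\<in>F. (cmod (w x))\<^sup>2) \<le> 1" "o' \<in> F" for w
      proof -
        have "(cmod (w o'))\<^sup>2 \<le> (\<Sum>x\<in>F. (cmod (w x))\<^sup>2)"
          by (rule member_le_sum) (use F that in auto)
        then have "(cmod (w o'))\<^sup>2 \<le> 1\<^sup>2" using that(1) by simp
        then show ?thesis by (rule power2_le_imp_le) simp
      qed
      have "(\<Sum>x\<in>F. \<Sum>y\<in>F. u x * A x y * v y) = (\<Sum>x\<in>F. if x = o' then (\<Sum>y\<in>F. if y = o' then u o' * v o' else 0) else 0)"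
        by (intro sum.cong refl) (auto simp: A_def intro!: sum.cong sum.neutral)
      then have "s = (if o' \<in> F then cmod (u o') * cmod (v o') else 0)"
        unfolding s using F by (simp add: norm_mult)
      then show ?thesis using le1[OF u] le1[OF v] by (auto intro: mult_le_one)
    qed
    moreover have "cmod (\<Sum>x\<in>{o'}. \<Sum>y\<in>{o'}. 1 * (\<Phi> (graph_dist E x y) * A x y) * 1) \<in>
        form_values (\<lambda>x y. \<Phi> (graph_dist E x y) * A x y)"
      by (rule form_valuesI) auto
    moreover have "graph_dist E o' o' = 0" using graph_dist_nb_walk[of "[o']"] by simp
    ultimately show "\<exists>A. (\<forall>s\<in>form_values A. s \<le> 1) \<and>
        (\<exists>t\<in>form_values (\<lambda>x y. \<Phi> (graph_dist E x y) * A x y). r \<le> t)"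
      using \<open>r < 1\<close> by (intro exI[of _ A]) (auto simp: A_def intro!: bexI[of _ 1])
  qed
qed

text \<open>Outside the strip \<open>U\<close> is bounded away from zero, so the weights \<open>1 / (i + 1)\<close>, which are
  square summable but not summable, give a bounded matrix with unbounded Schur product.\<close>

lemma not_schur_multiplier:
  assumes "1 \<le> cmod \<alpha> \<or> 1 \<le> cmod \<beta>" and "C \<noteq> 0"
  shows "\<not> schur_multiplier (\<lambda>x y. \<Phi> (graph_dist E x y))"
proof
  assume mult: "schur_multiplier (\<lambda>x y. \<Phi> (graph_dist E x y))"
  obtain \<delta> where \<delta>: "0 < \<delta>" "\<And>n. \<delta> \<le> cmod (U n)" using U_bounded_below[OF assms(1)] by blast
  define \<kappa> where "\<kappa> i = 1 / real (Suc i)" for i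
  have sq: "summable (\<lambda>i. (\<kappa> i)\<^sup>2)"
    using inverse_power_summable[of 2, where 'a = real] summable_Suc_iff[of "\<lambda>n. inverse (real n ^ 2)"]
    by (simp add: \<kappa>_def power_divide field_simps del: of_nat_Suc)
  define B where "B = (\<Sum>i. (\<kappa> i)\<^sup>2)"
  have "(\<Sum>i<n. (\<kappa> i)\<^sup>2) \<le> B" for n unfolding B_def by (rule sum_le_suminf[OF sq]) auto
  then obtain A where A: "\<forall>t\<in>form_values A. t \<le> B"
    and large: "\<And>N L. N \<le> L \<Longrightarrow> \<exists>t\<in>form_values (\<lambda>x y. \<Phi> (graph_dist E x y) * A x y).
      cmod C * (1 - 1 / real q) * (real (L - N) / real (Suc L)) * (\<Sum>i<N. cmod (U i) * \<kappa> i)\<^sup>2 \<le> t"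
    using ex_bounded_matrix_large_form[of \<kappa> B] by (auto simp: \<kappa>_def)
  have "bounded_matrix (\<lambda>x y. \<Phi> (graph_dist E x y) * A x y)"
    using mult bounded_matrixI[of A B] A unfolding schur_multiplier_def by blast
  then obtain K where K: "\<And>t. t \<in> form_values (\<lambda>x y. \<Phi> (graph_dist E x y) * A x y) \<Longrightarrow> t \<le> K"
    using form_values_le_matrix_norm by blast
  define c where "c = cmod C * (1 - 1 / real q)"
  have c: "0 < c" unfolding c_def using assms(2) q_ge_2 by simp
  \<comment> \<open>For fixed \<open>N\<close> the limit in \<open>L\<close> removes the averaging
    factor; what remains is a multiple of a squared harmonic sum.\<close>
  have bound: "c * (\<delta> * (\<Sum>i<N. \<kappa> i))\<^sup>2 \<le> K" for N
  proof -
    have lim: "(\<lambda>L. c * (real (L - N) / real (Suc L)) * (\<Sum>i<N. cmod (U i) * \<kappa> i)\<^sup>2) \<longlonglongrightarrow>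
        c * 1 * (\<Sum>i<N. cmod (U i) * \<kappa> i)\<^sup>2"
      by (intro tendsto_mult tendsto_const tendsto_ratio_1)
    have le: "c * (real (L - N) / real (Suc L)) * (\<Sum>i<N. cmod (U i) * \<kappa> i)\<^sup>2 \<le> K" if "N \<le> L" for L
      using large[OF that] K unfolding c_def by (meson order.trans)
    have "c * 1 * (\<Sum>i<N. cmod (U i) * \<kappa> i)\<^sup>2 \<le> K"
      by (rule LIMSEQ_le_const2[OF lim]) (use le in blast)
    moreover have "(\<delta> * (\<Sum>i<N. \<kappa> i))\<^sup>2 \<le> (\<Sum>i<N. cmod (U i) * \<kappa> i)\<^sup>2"
      unfolding sum_distrib_left using \<delta>
      by (intro power_mono sum_mono mult_right_mono sum_nonneg) (auto simp: \<kappa>_def)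
    then have "c * (\<delta> * (\<Sum>i<N. \<kappa> i))\<^sup>2 \<le> c * (\<Sum>i<N. cmod (U i) * \<kappa> i)\<^sup>2"
      using c by (intro mult_left_mono) auto
    ultimately show ?thesis by simp
  qed
  have "(\<Sum>i<N. \<kappa> i) \<le> sqrt (K / (c * \<delta>\<^sup>2))" for N
    by (rule real_le_rsqrt) (use bound[of N] c \<delta>(1) in \<open>simp add: pos_le_divide_eq power_mult_distrib mult_ac\<close>)
  then have "summable \<kappa>"
    by (intro summableI_nonneg_bounded) (auto simp: \<kappa>_def)
  moreover have "\<kappa> = (\<lambda>n. inverse (real (Suc n)))"
    by (simp add: fun_eq_iff \<kappa>_def inverse_eq_divide)
  ultimately show False
    using not_summable_harmonic[where 'a = real] summable_Suc_iff[of "\<lambda>n. inverse (real n)"]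
    by (simp only:)
qed

end

section \<open>The spherical functions\<close>

lemma qpow_add: "qpow q (v + w) = qpow q v * qpow q w"
  by (simp add: qpow_def distrib_right exp_add)

lemma qpow_mult_of_nat: "qpow q (w * of_nat n) = qpow q w ^ n"
  by (simp add: qpow_def exp_of_nat_mult[symmetric] mult_ac)

lemma qpow_of_nat:
  assumes "0 < q"
  shows "qpow q (of_nat n) = of_nat q ^ n"
proof -
  have "qpow q 1 = of_nat q"
    using assms by (simp add: qpow_def exp_of_real)
  then show ?thesis using qpow_mult_of_nat[of q 1 n] by simp
qed

lemma cnj_qpow: "cnj (qpow q w) = qpow q (cnj w)"
  by (simp add: qpow_def exp_cnj)

lemma norm_qpow: "0 < q \<Longrightarrow> cmod (qpow q w) = real q powr Re w"
  by (simp add: qpow_def powr_def)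

text \<open>The factor 2 is kept separate because the lemma is applied to the exponents
  \<open>- 2 * z\<close> and \<open>2 * z - 2\<close>, where it cancels.\<close>

lemma qpow_eq_1_iff:
  assumes "2 \<le> q"
  shows "qpow q w = 1 \<longleftrightarrow> (\<exists>k::int. w = 2 * \<i> * of_real (of_int k * pi / ln (real q)))"
proof -
  have l: "ln (real q) \<noteq> 0" using assms by simp
  have "qpow q w = 1 \<longleftrightarrow> (\<exists>k::int. w * of_real (ln (real q)) = of_int (2 * k) * pi * \<i>)"
    unfolding qpow_def complex_eq_iff[of "_ * _"] exp_eq_1
    by (auto simp: mult_ac)
  also have "\<dots> \<longleftrightarrow> (\<exists>k::int. w = 2 * \<i> * of_real (of_int k * pi / ln (real q)))"
    using l by (intro ex_cong1) (auto simp: field_simps)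
  finally show ?thesis .
qed

lemma spherical_qpow:
  assumes "2 \<le> q"
  shows "spherical q (qpow q (- z)) (qpow q (z - 1))"
proof
  have "qpow q (- z) * qpow q (z - 1) * qpow q 1 = 1"
    unfolding qpow_add[symmetric] by (simp add: qpow_def)
  then show "qpow q (- z) * qpow q (z - 1) = 1 / of_nat q"
    using assms qpow_of_nat[of q 1] by (simp add: field_simps)
qed (rule assms)

lemma (in spherical) \<Phi>_closed:
  assumes "\<alpha> \<noteq> \<beta>"
  shows "\<Phi> n = inverse (of_nat q + 1) * ((of_nat q * \<alpha> - \<beta>) / (\<alpha> - \<beta>)) * \<alpha> ^ n +
    inverse (of_nat q + 1) * ((of_nat q * \<beta> - \<alpha>) / (\<beta> - \<alpha>)) * \<beta> ^ n"
proof -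
  have q1: "(of_nat q + 1 :: complex) \<noteq> 0" by (metis of_nat_Suc of_nat_neq_0 add.commute)
  have d: "\<alpha> - \<beta> \<noteq> 0" using assms by simp
  have common: "inverse e * (A / d) * x + inverse e * - (B / d) * y = (A * x - B * y) / (e * d)"
    for e A B d x y :: complex
    by (simp add: divide_inverse algebra_simps)
  have swap: "B / (\<beta> - \<alpha>) = - (B / (\<alpha> - \<beta>))" for B
    by (metis minus_diff_eq minus_divide_right)
  have "inverse (of_nat q + 1) * ((of_nat q * \<alpha> - \<beta>) / (\<alpha> - \<beta>)) * \<alpha> ^ n +
    inverse (of_nat q + 1) * ((of_nat q * \<beta> - \<alpha>) / (\<beta> - \<alpha>)) * \<beta> ^ n =
    ((of_nat q * \<alpha> - \<beta>) * \<alpha> ^ n - (of_nat q * \<beta> - \<alpha>) * \<beta> ^ n) / ((of_nat q + 1) * (\<alpha> - \<beta>))"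
    (is "?rhs = _")
    unfolding swap by (rule common)
  then have rhs: "((of_nat q + 1) * (\<alpha> - \<beta>)) * ?rhs =
      (of_nat q * \<alpha> - \<beta>) * \<alpha> ^ n - (of_nat q * \<beta> - \<alpha>) * \<beta> ^ n"
    using d q1 by simp
  have "((of_nat q + 1) * (\<alpha> - \<beta>)) * \<Phi> n =
      (of_nat q * \<alpha> - \<beta>) * \<alpha> ^ n - (of_nat q * \<beta> - \<alpha>) * \<beta> ^ n"
  proof (cases n rule: \<Phi>.cases)
    case 1 then show ?thesis by (simp add: algebra_simps)
  next
    case 2
    have "((of_nat q + 1) * (\<alpha> - \<beta>)) * \<Phi> n = (\<alpha> - \<beta>) * (of_nat q * (\<alpha> + \<beta>))"
      using q1 2 by simp
    then show ?thesis using 2 by (simp add: algebra_simps)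
  next
    case (3 m)
    have "((of_nat q + 1) * (\<alpha> - \<beta>)) * \<Phi> n =
        (\<alpha> - \<beta>) * (of_nat q * U (Suc (Suc m)) - U m / of_nat q)"
      using q1 3 by simp
    also have "\<dots> = of_nat q * ((\<alpha> - \<beta>) * U (Suc (Suc m))) - 1 / of_nat q * ((\<alpha> - \<beta>) * U m)"
      by (simp add: right_diff_distrib mult_ac)
    \<comment> \<open>Writing \<open>1 / q\<close> as \<open>\<alpha> * \<beta>\<close> raises the
      lower powers to the exponent \<open>n\<close>.\<close>
    also have "\<dots> = of_nat q * (\<alpha> ^ Suc n - \<beta> ^ Suc n) - \<alpha> * \<beta> * (\<alpha> ^ Suc m - \<beta> ^ Suc m)"
      unfolding U_closed 3 prod_eq ..
    also have "\<dots> = (of_nat q * \<alpha> - \<beta>) * \<alpha> ^ n - (of_nat q * \<beta> - \<alpha>) * \<beta> ^ n"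
      unfolding 3 by (simp add: algebra_simps)
    finally show ?thesis .
  qed
  then show ?thesis unfolding rhs[symmetric] using d q1 by simp
qed

lemma sph_raw_eq_\<Phi>:
  assumes "2 \<le> q" "qpow q (- z) \<noteq> qpow q (z - 1)"
  shows "sph_raw q z n = spherical.\<Phi> q (qpow q (- z)) (qpow q (z - 1)) n"
proof -
  interpret spherical q "qpow q (- z)" "qpow q (z - 1)" by (rule spherical_qpow[OF assms(1)])
  have q: "qpow q 1 = of_nat q" using qpow_of_nat[of q 1] by simp
  have "qpow q (1 - z) = of_nat q * qpow q (- z)" "qpow q z = of_nat q * qpow q (z - 1)"
    unfolding q[symmetric] qpow_add[symmetric] by simp_all
  moreover have "qpow q (- z * of_nat n) = qpow q (- z) ^ n"
    "qpow q (- (1 - z) * of_nat n) = qpow q (z - 1) ^ n"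
    unfolding qpow_mult_of_nat by simp_all
  ultimately show ?thesis
    unfolding \<Phi>_closed[OF assms(2)] sph_raw_def sph_f_def by (simp add: mult.assoc)
qed

text \<open>\<open>\<Phi>\<close> is a polynomial in two exponentials of \<open>w\<close>, so
  nothing is singular where they coincide.\<close>

lemma continuous_\<Phi>_qpow:
  assumes "2 \<le> q"
  shows "isCont (\<lambda>w. spherical.\<Phi> q (qpow q (- w)) (qpow q (w - 1)) n) z"
proof -
  note sp = spherical_qpow[OF assms]
  have U: "isCont (\<lambda>w. spherical.U (qpow q (- w)) (qpow q (w - 1)) n) z" for n
    unfolding spherical.U_def[OF sp] unfolding qpow_def by (intro continuous_intros)
  have q1: "(of_nat q + 1 :: complex) \<noteq> 0" by (metis of_nat_Suc of_nat_neq_0 add.commute)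
  have q0: "(of_nat q :: complex) \<noteq> 0" using assms by simp
  show ?thesis
  proof (cases n rule: spherical.\<Phi>.cases[OF sp])
    case 1 then show ?thesis by (simp add: spherical.\<Phi>.simps[OF sp])
  next
    case 2
    then show ?thesis unfolding 2 spherical.\<Phi>.simps[OF sp] unfolding qpow_def
      using q1 by (intro continuous_intros)
  next
    case (3 m)
    then show ?thesis unfolding 3 spherical.\<Phi>.simps[OF sp]
      using q1 q0 by (intro continuous_intros U)
  qed
qed

text \<open>Where the two exponentials agree, their difference has derivative
  \<open>- 2 * ln q\<close> times a nonzero value, so the zero is isolated.\<close>

lemma eventually_qpow_neq:
  assumes "2 \<le> q" "qpow q (- z) = qpow q (z - 1)"
  shows "eventually (\<lambda>w. qpow q (- w) \<noteq> qpow q (w - 1)) (at z)"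
proof -
  define g where "g w = qpow q (- w) - qpow q (w - 1)" for w
  define D where "D = - of_real (ln (real q)) * (qpow q (- z) + qpow q (z - 1))"
  have "(g has_field_derivative D) (at z)"
    unfolding g_def D_def qpow_def by (auto intro!: derivative_eq_intros simp: algebra_simps)
  then have "((\<lambda>w. (g w - g z) / (w - z)) \<longlongrightarrow> D) (at z)"
    unfolding has_field_derivative_iff .
  moreover have "D \<noteq> 0"
  proof -
    have "ln (real q) \<noteq> 0" using assms(1) by simp
    then show ?thesis unfolding D_def assms(2) by (simp add: qpow_def)
  qed
  ultimately have "eventually (\<lambda>w. (g w - g z) / (w - z) \<noteq> 0) (at z)"
    by (rule tendsto_imp_eventually_ne)
  then show ?thesis
    by (rule eventually_mono) (use assms(2) in \<open>auto simp: g_def\<close>)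
qed

text \<open>At a removable singularity \<open>sph_raw\<close> agrees with the continuous function
  \<open>\<Phi>\<close> on a punctured neighbourhood, so the limit is the value of
  \<open>\<Phi>\<close>.\<close>

lemma sph_dot_eq_\<Phi>:
  assumes "2 \<le> q"
  shows "sph_dot q z n = spherical.\<Phi> q (qpow q (- z)) (qpow q (z - 1)) n"
proof (cases "qpow q (- z) = qpow q (z - 1)")
  case True
  have "((\<lambda>w. spherical.\<Phi> q (qpow q (- w)) (qpow q (w - 1)) n) \<longlongrightarrow>
      spherical.\<Phi> q (qpow q (- z)) (qpow q (z - 1)) n) (at z)"
    using continuous_\<Phi>_qpow[OF assms] unfolding isCont_def .
  moreover have "eventually (\<lambda>w. spherical.\<Phi> q (qpow q (- w)) (qpow q (w - 1)) n = sph_raw q w n) (at z)"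
    by (rule eventually_mono[OF eventually_qpow_neq[OF assms True]]) (simp add: sph_raw_eq_\<Phi>[OF assms])
  ultimately have "((\<lambda>w. sph_raw q w n) \<longlongrightarrow> spherical.\<Phi> q (qpow q (- z)) (qpow q (z - 1)) n) (at z)"
    by (rule Lim_transform_eventually)
  then show ?thesis unfolding sph_dot_def using True by (simp add: tendsto_Lim)
qed (simp add: sph_dot_def sph_raw_eq_\<Phi>[OF assms])

text \<open>The factor \<open>q / (q + 1)\<close> of \<open>C\<close> cancels against
  \<open>1 - 1 / q^2 = (1 - 1 / q) * (q + 1) / q\<close> from the square sum, which leaves the
  square of \<open>1 - 1 / q\<close>.\<close>

lemma strip_norm_formula:
  fixes q :: nat and z :: complex
  assumes "2 \<le> q" "0 < Re z" "Re z < 1"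
  defines "\<alpha> \<equiv> qpow q (- z)" and "\<beta> \<equiv> qpow q (z - 1)"
  shows "cmod (spherical.C q \<alpha> \<beta>) * ((1 - 1 / real q) * (\<Sum>n. (cmod (spherical.U \<alpha> \<beta> n))\<^sup>2)) =
     ((1 - 1 / real q)\<^sup>2 * cmod (1 - qpow q (- 2 * z)) * cmod (1 - qpow q (2 * z - 2)))
             / ((1 - real q powr (- 2 * Re z)) * (1 - real q powr (2 * Re z - 2))
                * (cmod (1 - qpow q (2 * \<i> * of_real (Im z) - 1)))\<^sup>2)"
proof -
  interpret spherical q \<alpha> \<beta> unfolding \<alpha>_def \<beta>_def by (rule spherical_qpow[OF assms(1)])
  have norms: "cmod \<alpha> < 1" "cmod \<beta> < 1"
    unfolding \<alpha>_def \<beta>_def using assms by (simp_all add: norm_qpow powr_less_one)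
  have sq: "\<alpha>\<^sup>2 = qpow q (- 2 * z)" "\<beta>\<^sup>2 = qpow q (2 * z - 2)"
    unfolding \<alpha>_def \<beta>_def power2_eq_square qpow_add[symmetric] by simp_all
  have nsq: "(cmod \<alpha>)\<^sup>2 = real q powr (- 2 * Re z)" "(cmod \<beta>)\<^sup>2 = real q powr (2 * Re z - 2)"
    unfolding norm_power[symmetric] sq by (simp_all add: norm_qpow)
  have "cnj (1 - \<alpha> * cnj \<beta>) = 1 - qpow q (2 * \<i> * of_real (Im z) - 1)"
  proof -
    have "- cnj z + (z - 1) = 2 * \<i> * of_real (Im z) - 1" by (simp add: complex_eq_iff)
    then show ?thesis unfolding \<alpha>_def \<beta>_def
      by (simp only: complex_cnj_diff complex_cnj_one complex_cnj_mult complex_cnj_cnj cnj_qpow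
          complex_cnj_minus complex_cnj_add qpow_add[symmetric])
  qed
  then have cross: "cmod (1 - \<alpha> * cnj \<beta>) = cmod (1 - qpow q (2 * \<i> * of_real (Im z) - 1))"
    by (metis complex_mod_cnj)
  have C: "cmod C = real q * cmod (1 - qpow q (- 2 * z)) * cmod (1 - qpow q (2 * z - 2)) / (real q + 1)"
  proof -
    have "cmod (of_nat q + 1) = real q + 1" by (metis norm_of_nat of_nat_Suc add.commute)
    then show ?thesis unfolding C_def sq by (simp add: norm_mult norm_divide)
  qed
  have S: "(\<Sum>n. (cmod (U n))\<^sup>2) = (1 - 1 / (real q)\<^sup>2) / ((1 - real q powr (- 2 * Re z)) *
      (1 - real q powr (2 * Re z - 2)) * (cmod (1 - qpow q (2 * \<i> * of_real (Im z) - 1)))\<^sup>2)"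
    using sums_unique[OF sums_U_sq[OF norms]] unfolding nsq cross by simp
  have "real q * a * b / (real q + 1) * ((1 - 1 / real q) * ((1 - 1 / (real q)\<^sup>2) / d)) =
      (1 - 1 / real q)\<^sup>2 * a * b / d" for a b d
  proof -
    have "1 - 1 / (real q)\<^sup>2 = (1 - 1 / real q) * ((real q + 1) / real q)"
      by (simp add: field_simps power2_eq_square)
    moreover have "real q + 1 \<noteq> 0" by (metis of_nat_Suc of_nat_neq_0 add.commute)
    ultimately show ?thesis by (simp add: power2_eq_square)
  qed
  then show ?thesis unfolding C S .
qed

theorem theorem2p2:
  fixes E :: "'a \<Rightarrow> 'a \<Rightarrow> bool" and q :: nat and z :: complex
  assumes "homogeneous_tree E (q + 1)" and "2 \<le> q"
  shows "(schur_multiplier (\<lambda>x y. sph_dot q z (graph_dist E x y)) \<longleftrightarrow>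
           z \<in> {w. 0 < Re w \<and> Re w < 1}
             \<union> {\<i> * of_real (of_int k * pi / ln (real q)) | k. True}
             \<union> {1 - \<i> * of_real (of_int k * pi / ln (real q)) | k. True})
         \<and> (0 < Re z \<and> Re z < 1 \<longrightarrow>
           schur_norm (\<lambda>x y. sph_dot q z (graph_dist E x y)) =
             ((1 - 1 / real q)\<^sup>2 * cmod (1 - qpow q (- 2 * z)) * cmod (1 - qpow q (2 * z - 2)))
             / ((1 - real q powr (- 2 * Re z)) * (1 - real q powr (2 * Re z - 2))
                * (cmod (1 - qpow q (2 * \<i> * of_real (Im z) - 1)))\<^sup>2))
         \<and> (z \<in> {\<i> * of_real (of_int k * pi / ln (real q)) | k. True}
             \<union> {1 - \<i> * of_real (of_int k * pi / ln (real q)) | k. True} \<longrightarrow>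
           schur_norm (\<lambda>x y. sph_dot q z (graph_dist E x y)) = 1)"
proof -
  define \<alpha> \<beta> where "\<alpha> = qpow q (- z)" and "\<beta> = qpow q (z - 1)"
  interpret spherical q \<alpha> \<beta> unfolding \<alpha>_def \<beta>_def by (rule spherical_qpow[OF assms(2)])
  interpret spherical_tree q E \<alpha> \<beta> by unfold_locales (rule assms(1))
  define Z where "Z = {\<i> * of_real (of_int k * pi / ln (real q)) | k. True}
    \<union> {1 - \<i> * of_real (of_int k * pi / ln (real q)) | k. True}"
  have dot: "sph_dot q z n = \<Phi> n" for n
    unfolding sph_dot_eq_\<Phi>[OF assms(2)] \<alpha>_def \<beta>_def ..
  have norm_\<alpha>: "cmod \<alpha> < 1 \<longleftrightarrow> 0 < Re z" and norm_\<beta>: "cmod \<beta> < 1 \<longleftrightarrow> Re z < 1"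
    unfolding \<alpha>_def \<beta>_def using assms(2) powr_less_cancel_iff[of "real q" _ 0]
    by (simp_all add: norm_qpow)
  have C_iff: "C = 0 \<longleftrightarrow> z \<in> Z"
  proof -
    define X where "X k = complex_of_real (of_int k * pi / ln (real q))" for k
    have X: "X (- k) = - X k" for k by (simp add: X_def)
    have sq: "\<alpha>\<^sup>2 = qpow q (- 2 * z)" "\<beta>\<^sup>2 = qpow q (2 * z - 2)"
      unfolding \<alpha>_def \<beta>_def power2_eq_square qpow_add[symmetric] by simp_all
    have "C = 0 \<longleftrightarrow> (\<exists>k. - 2 * z = 2 * \<i> * X k) \<or> (\<exists>k. 2 * z - 2 = 2 * \<i> * X k)"
      unfolding C_eq_0_iff sq qpow_eq_1_iff[OF assms(2)] X_def ..
    \<comment> \<open>The sign of \<open>k\<close> is flipped to match the two families of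
      points.\<close>
    also have "\<dots> \<longleftrightarrow> (\<exists>k. z = \<i> * X (- k)) \<or> (\<exists>k. z = 1 - \<i> * X (- k))"
      unfolding X by (intro arg_cong2[of _ _ _ _ "(\<or>)"] ex_cong1) (auto simp: complex_eq_iff)
    also have "\<dots> \<longleftrightarrow> (\<exists>k. z = \<i> * X k) \<or> (\<exists>k. z = 1 - \<i> * X k)" by (metis minus_minus)
    finally show ?thesis unfolding Z_def X_def by blast
  qed
  have not_strip: "\<not> (0 < Re z \<and> Re z < 1) \<Longrightarrow> 1 \<le> cmod \<alpha> \<or> 1 \<le> cmod \<beta>"
    using norm_\<alpha> norm_\<beta> by linarith
  show ?thesis
    unfolding dot Un_assoc Z_def[symmetric]
  proof (intro conjI impI)
    \<comment> \<open>Inside the strip \<open>schur_strip\<close> applies. Outside it one of the two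
      moduli is at least 1, and the vanishing of \<open>C\<close> decides.\<close>
    show "schur_multiplier (\<lambda>x y. \<Phi> (graph_dist E x y)) \<longleftrightarrow> z \<in> {w. 0 < Re w \<and> Re w < 1} \<union> Z"
      using schur_strip(1) schur_sign(1) not_schur_multiplier not_strip norm_\<alpha> norm_\<beta> C_iff by blast
  next
    assume "0 < Re z \<and> Re z < 1"
    then show "schur_norm (\<lambda>x y. \<Phi> (graph_dist E x y)) =
             ((1 - 1 / real q)\<^sup>2 * cmod (1 - qpow q (- 2 * z)) * cmod (1 - qpow q (2 * z - 2)))
             / ((1 - real q powr (- 2 * Re z)) * (1 - real q powr (2 * Re z - 2))
                * (cmod (1 - qpow q (2 * \<i> * of_real (Im z) - 1)))\<^sup>2)"
      using schur_strip(2) norm_\<alpha> norm_\<beta> strip_norm_formula[OF assms(2), of z]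
      unfolding \<alpha>_def \<beta>_def by metis
  next
    assume "z \<in> Z"
    then show "schur_norm (\<lambda>x y. \<Phi> (graph_dist E x y)) = 1"
      using C_iff schur_sign(2) by blast
  qed
qed

end
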